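(* Let $\bar\pi$ be a finite projective plane of order $n>1$ and let $G$ be a collineation group of $\bar\pi$ having an orbit of size $n^3$ on the flags of $\bar\pi$. Then $G$ fixes a flag $(p,L)$ and is transitive on the flags $(w,W)$ with $w$ not on $L$ and $p$ not on $W$ (so $G$ is a soft group and $\bar\pi$ is a soft plane). Moreover, there are subgroups $A,B,M$ of $G$ such that (1) $|A|=|B|=|M|=nk$ and $|G|=n^3k$, where $k=|A\cap B|$; (2) $AM$ and $BM$ are subgroups of $G$ of order $n^2k$; (3) $G=AMB$; (4) $AB\cap BA=A\cup B$; and the coset plane $\pi(G,A,B,M)$ is isomorphic to $\bar\pi$. In particular, every soft plane is isomorphic to a coset plane $\pi(G,A,B,M)$ for some finite group $G$ with subgroups $A,B,M$ satisfying (1)–(4).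
   Context: A flag is an incident point–line pair. A collineation group $H$ of a finite projective plane is a soft group if it fixes a flag $(\infty,L_\infty)$ and is transitive on the flags $(w,W)$ with $w$ not on $L_\infty$ and $\infty$ not on $W$; a plane admitting a soft group is a soft plane. Given a finite group $G$ with subgroups $A,B,M$ satisfying (1)–(4) for an integer $n>1$, the coset plane $\pi(G,A,B,M)$ is the incidence structure whose points are a symbol $\infty$, the right cosets $Ax$ and the right cosets $BMx$ ($x\in G$), and whose lines are a symbol $L_\infty$, the right cosets $By$ and the right cosets $AMy$ ($y\in G$), with incidences: $Ax$ is on $By$ iff $Ax\cap By\neq\emptyset$; $Ax$ is on $AMy$ iff $Ax\subseteq AMy$; $BMx$ is on $By$ iff $By\subseteq BMx$; every $BMx$ and $\infty$ are on $L_\infty$; $\infty$ is on every $AMy$; and there are no other incidences. It is a projective plane of order $n$. *)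

theory Defs
  imports "HOL-Algebra.Group_Action"
begin

section \<open>Projective planes\<close>

record ('p, 'l) incidence_structure =
  points :: "'p set"
  lines :: "'l set"
  incident :: "'p \<Rightarrow> 'l \<Rightarrow> bool"

definition projective_plane :: "('p, 'l) incidence_structure \<Rightarrow> bool" where
  "projective_plane \<pi> \<longleftrightarrow>
     (\<forall>p\<in>points \<pi>. \<forall>q\<in>points \<pi>. p \<noteq> q \<longrightarrow>
        (\<exists>!l. l \<in> lines \<pi> \<and> incident \<pi> p l \<and> incident \<pi> q l)) \<and>
     (\<forall>l\<in>lines \<pi>. \<forall>m\<in>lines \<pi>. l \<noteq> m \<longrightarrow>
        (\<exists>!p. p \<in> points \<pi> \<and> incident \<pi> p l \<and> incident \<pi> p m)) \<and>
     (\<exists>Q\<subseteq>points \<pi>. card Q = 4 \<and>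
        (\<forall>T\<subseteq>Q. card T = 3 \<longrightarrow> \<not> (\<exists>l\<in>lines \<pi>. \<forall>p\<in>T. incident \<pi> p l)))"

definition finite_projective_plane :: "('p, 'l) incidence_structure \<Rightarrow> bool" where
  "finite_projective_plane \<pi> \<longleftrightarrow>
     projective_plane \<pi> \<and> finite (points \<pi>) \<and> finite (lines \<pi>)"

definition has_plane_order :: "('p, 'l) incidence_structure \<Rightarrow> nat \<Rightarrow> bool" where
  "has_plane_order \<pi> n \<longleftrightarrow>
     (\<forall>l\<in>lines \<pi>. card {p \<in> points \<pi>. incident \<pi> p l} = n + 1)"

definition flags :: "('p, 'l) incidence_structure \<Rightarrow> ('p \<times> 'l) set" where
  "flags \<pi> = {(p, l). p \<in> points \<pi> \<and> l \<in> lines \<pi> \<and> incident \<pi> p l}"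


section \<open>Isomorphisms and collineations\<close>

definition incidence_isomorphism ::
  "('p, 'l) incidence_structure \<Rightarrow> ('q, 'm) incidence_structure \<Rightarrow> ('p \<Rightarrow> 'q) \<Rightarrow> ('l \<Rightarrow> 'm) \<Rightarrow> bool"
  where
  "incidence_isomorphism \<pi> \<sigma> f g \<longleftrightarrow>
     bij_betw f (points \<pi>) (points \<sigma>) \<and> bij_betw g (lines \<pi>) (lines \<sigma>) \<and>
     (\<forall>p\<in>points \<pi>. \<forall>l\<in>lines \<pi>. incident \<pi> p l \<longleftrightarrow> incident \<sigma> (f p) (g l))"

definition isomorphic_structures ::
  "('p, 'l) incidence_structure \<Rightarrow> ('q, 'm) incidence_structure \<Rightarrow> bool" where
  "isomorphic_structures \<pi> \<sigma> \<longleftrightarrow> (\<exists>f g. incidence_isomorphism \<pi> \<sigma> f g)"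

text \<open>A collineation is represented by its actions on points and on lines. As in
  \<^const>\<open>BijGroup\<close>, both components are extensional, so that distinct pairs are distinct
  collineations, and the product is composition of maps written on the left.\<close>

definition collineation_group ::
  "('p, 'l) incidence_structure \<Rightarrow> (('p \<Rightarrow> 'p) \<times> ('l \<Rightarrow> 'l)) monoid" where
  "collineation_group \<pi> = (BijGroup (points \<pi>) \<times>\<times> BijGroup (lines \<pi>))
     \<lparr>carrier := {(f, g). f \<in> Bij (points \<pi>) \<and> g \<in> Bij (lines \<pi>) \<and>
                         incidence_isomorphism \<pi> \<pi> f g}\<rparr>"

definition flag_action :: "('p \<Rightarrow> 'p) \<times> ('l \<Rightarrow> 'l) \<Rightarrow> 'p \<times> 'l \<Rightarrow> 'p \<times> 'l" where
  "flag_action h = map_prod (fst h) (snd h)"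

lemma group_collineation_group: "group (collineation_group \<pi>)"
proof -
  let ?D = "BijGroup (points \<pi>) \<times>\<times> BijGroup (lines \<pi>)"
  let ?C = "carrier (collineation_group \<pi>)"
  interpret D: group ?D
    by (intro DirProd_group group_BijGroup)
  have inv: "inv\<^bsub>BijGroup S\<^esub> f = restrict (inv_into S f) S" if "f \<in> Bij S" for f :: "'z \<Rightarrow> 'z" and S
  proof -
    interpret B: group "BijGroup S" by (rule group_BijGroup)
    show ?thesis
    proof (rule B.inv_equality)
      show "restrict (inv_into S f) S \<otimes>\<^bsub>BijGroup S\<^esub> f = \<one>\<^bsub>BijGroup S\<^esub>"
        using that by (simp add: BijGroup_def restrict_inv_into_Bij Bij_compose_restrict_eq)
    qed (use that in \<open>simp_all add: BijGroup_def restrict_inv_into_Bij\<close>)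
  qed
  have "subgroup ?C ?D"
  proof (rule D.subgroupI)
    show "?C \<subseteq> carrier ?D"
      by (auto simp: collineation_group_def BijGroup_def)
    have "(\<lambda>x\<in>points \<pi>. x, \<lambda>x\<in>lines \<pi>. x) \<in> ?C"
      by (auto simp: collineation_group_def id_Bij incidence_isomorphism_def bij_betw_def
            inj_on_def)
    then show "?C \<noteq> {}" by blast
  next
    fix a assume a: "a \<in> ?C"
    obtain f g where [simp]: "a = (f, g)" by (cases a)
    have fg: "f \<in> Bij (points \<pi>)" "g \<in> Bij (lines \<pi>)" "incidence_isomorphism \<pi> \<pi> f g"
      using a by (auto simp: collineation_group_def)
    let ?f = "restrict (inv_into (points \<pi>) f) (points \<pi>)"
    let ?g = "restrict (inv_into (lines \<pi>) g) (lines \<pi>)"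
    have b: "?f \<in> Bij (points \<pi>)" "?g \<in> Bij (lines \<pi>)"
      using fg by (simp_all add: restrict_inv_into_Bij)
    have "incident \<pi> p l \<longleftrightarrow> incident \<pi> (?f p) (?g l)" if "p \<in> points \<pi>" "l \<in> lines \<pi>" for p l
    proof -
      have "?f p \<in> points \<pi>" "?g l \<in> lines \<pi>"
        using b that by (metis Bij_imp_funcset funcset_mem)+
      moreover have "f (?f p) = p" "g (?g l) = l"
        using fg that by (simp_all add: Bij_def bij_betw_def f_inv_into_f)
      ultimately show ?thesis
        using fg(3) unfolding incidence_isomorphism_def by metis
    qed
    then have "(?f, ?g) \<in> ?C"
      using b by (simp add: collineation_group_def incidence_isomorphism_def Bij_def)
    moreover have "inv\<^bsub>?D\<^esub> a = (?f, ?g)"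
    proof -
      have "f \<in> carrier (BijGroup (points \<pi>))" "g \<in> carrier (BijGroup (lines \<pi>))"
        using fg by (simp_all add: BijGroup_def)
      then show ?thesis
        using fg by (simp add: inv_DirProd[OF group_BijGroup group_BijGroup] inv)
    qed
    ultimately show "inv\<^bsub>?D\<^esub> a \<in> ?C" by simp
  next
    fix a b assume ab: "a \<in> ?C" "b \<in> ?C"
    obtain f g f' g' where [simp]: "a = (f, g)" "b = (f', g')" by (cases a, cases b)
    have f: "f \<in> Bij (points \<pi>)" "g \<in> Bij (lines \<pi>)" "incidence_isomorphism \<pi> \<pi> f g"
      and f': "f' \<in> Bij (points \<pi>)" "g' \<in> Bij (lines \<pi>)" "incidence_isomorphism \<pi> \<pi> f' g'"
      using ab by (auto simp: collineation_group_def)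
    let ?f = "compose (points \<pi>) f f'" and ?g = "compose (lines \<pi>) g g'"
    have b: "?f \<in> Bij (points \<pi>)" "?g \<in> Bij (lines \<pi>)"
      using f f' by (simp_all add: compose_Bij)
    have "incident \<pi> p l \<longleftrightarrow> incident \<pi> (?f p) (?g l)" if "p \<in> points \<pi>" "l \<in> lines \<pi>" for p l
    proof -
      have "f' p \<in> points \<pi>" "g' l \<in> lines \<pi>"
        using f' that by (metis Bij_imp_funcset funcset_mem)+
      then have "incident \<pi> p l \<longleftrightarrow> incident \<pi> (f (f' p)) (g (g' l))"
        using f(3) f'(3) that unfolding incidence_isomorphism_def by metis
      then show ?thesis
        using that by (simp add: compose_eq)
    qed
    then have "(?f, ?g) \<in> ?C"
      using b by (simp add: collineation_group_def incidence_isomorphism_def Bij_def)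
    then show "a \<otimes>\<^bsub>?D\<^esub> b \<in> ?C"
      using f f' by (simp add: BijGroup_def)
  qed
  then have "group (?D\<lparr>carrier := ?C\<rparr>)"
    by (rule D.subgroup_imp_group)
  moreover have "?D\<lparr>carrier := ?C\<rparr> = collineation_group \<pi>"
    by (simp add: collineation_group_def)
  ultimately show ?thesis by simp
qed


section \<open>Soft groups and soft planes\<close>

definition opposite_flags ::
  "('p, 'l) incidence_structure \<Rightarrow> 'p \<Rightarrow> 'l \<Rightarrow> ('p \<times> 'l) set" where
  "opposite_flags \<pi> p L = {(w, W) \<in> flags \<pi>. \<not> incident \<pi> w L \<and> \<not> incident \<pi> p W}"

definition soft_at ::
  "('p, 'l) incidence_structure \<Rightarrow> (('p \<Rightarrow> 'p) \<times> ('l \<Rightarrow> 'l)) set \<Rightarrow> 'p \<Rightarrow> 'l \<Rightarrow> bool" where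
  "soft_at \<pi> H p L \<longleftrightarrow>
     (p, L) \<in> flags \<pi> \<and>
     (\<forall>h\<in>H. flag_action h (p, L) = (p, L)) \<and>
     (\<forall>x\<in>opposite_flags \<pi> p L. \<forall>y\<in>opposite_flags \<pi> p L. \<exists>h\<in>H. flag_action h x = y)"

definition soft_group ::
  "('p, 'l) incidence_structure \<Rightarrow> (('p \<Rightarrow> 'p) \<times> ('l \<Rightarrow> 'l)) set \<Rightarrow> bool" where
  "soft_group \<pi> H \<longleftrightarrow>
     finite_projective_plane \<pi> \<and> subgroup H (collineation_group \<pi>) \<and> (\<exists>p L. soft_at \<pi> H p L)"

definition soft_plane :: "('p, 'l) incidence_structure \<Rightarrow> bool" where
  "soft_plane \<pi> \<longleftrightarrow> (\<exists>H. soft_group \<pi> H)"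


section \<open>Coset planes\<close>

definition coset_plane_data ::
  "('g, 'b) monoid_scheme \<Rightarrow> 'g set \<Rightarrow> 'g set \<Rightarrow> 'g set \<Rightarrow> nat \<Rightarrow> bool" where
  "coset_plane_data G A B M n \<longleftrightarrow>
     group G \<and> finite (carrier G) \<and> subgroup A G \<and> subgroup B G \<and> subgroup M G \<and>
     (let k = card (A \<inter> B) in
        card A = n * k \<and> card B = n * k \<and> card M = n * k \<and> order G = n ^ 3 * k \<and>
        subgroup (A <#>\<^bsub>G\<^esub> M) G \<and> card (A <#>\<^bsub>G\<^esub> M) = n ^ 2 * k \<and>
        subgroup (B <#>\<^bsub>G\<^esub> M) G \<and> card (B <#>\<^bsub>G\<^esub> M) = n ^ 2 * k) \<and>
     carrier G = A <#>\<^bsub>G\<^esub> M <#>\<^bsub>G\<^esub> B \<and>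
     (A <#>\<^bsub>G\<^esub> B) \<inter> (B <#>\<^bsub>G\<^esub> A) = A \<union> B"

datatype 'g coset_point = Point_inf | Point_A "'g set" | Point_BM "'g set"

datatype 'g coset_line = Line_inf | Line_B "'g set" | Line_AM "'g set"

fun coset_incident :: "'g coset_point \<Rightarrow> 'g coset_line \<Rightarrow> bool" where
  "coset_incident (Point_A X) (Line_B Y) \<longleftrightarrow> X \<inter> Y \<noteq> {}"
| "coset_incident (Point_A X) (Line_AM Y) \<longleftrightarrow> X \<subseteq> Y"
| "coset_incident (Point_A X) Line_inf \<longleftrightarrow> False"
| "coset_incident (Point_BM X) (Line_B Y) \<longleftrightarrow> Y \<subseteq> X"
| "coset_incident (Point_BM X) (Line_AM Y) \<longleftrightarrow> False"
| "coset_incident (Point_BM X) Line_inf \<longleftrightarrow> True"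
| "coset_incident Point_inf (Line_B Y) \<longleftrightarrow> False"
| "coset_incident Point_inf (Line_AM Y) \<longleftrightarrow> True"
| "coset_incident Point_inf Line_inf \<longleftrightarrow> True"

definition coset_plane ::
  "('g, 'b) monoid_scheme \<Rightarrow> 'g set \<Rightarrow> 'g set \<Rightarrow> 'g set \<Rightarrow>
   ('g coset_point, 'g coset_line) incidence_structure" where
  "coset_plane G A B M =
     \<lparr>points = {Point_inf} \<union> Point_A ` (rcosets\<^bsub>G\<^esub> A) \<union> Point_BM ` (rcosets\<^bsub>G\<^esub> (B <#>\<^bsub>G\<^esub> M)),
      lines = {Line_inf} \<union> Line_B ` (rcosets\<^bsub>G\<^esub> B) \<union> Line_AM ` (rcosets\<^bsub>G\<^esub> (A <#>\<^bsub>G\<^esub> M)),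
      incident = coset_incident\<rparr>"

end

theory Submission
  imports Defs
begin

text \<open>The points of an orbit of \<open>n\<^sup>3\<close> flags form a point orbit of size \<open>m\<close>, each on the
  same number \<open>a \<le> n + 1\<close> of flags of the orbit, and \<open>m a = n\<^sup>3\<close> with \<open>m \<le> n\<^sup>2 + n + 1\<close>
  forces \<open>a = n\<close> and \<open>m = n\<^sup>2\<close>; dually for lines. Every line of the line orbit then misses the
  point orbit in exactly one point, so the remaining \<open>n + 1\<close> points form a line \<open>L\<close>; dually the
  remaining lines form the pencil of a point \<open>p\<close> on \<open>L\<close>. Comparing cardinalities, the orbit
  consists of all flags opposite to \<open>(p, L)\<close>.

  For an opposite flag \<open>(w, W)\<close> let \<open>X = pw\<close> and let \<open>x\<close> be the intersection of \<open>W\<close> and \<open>L\<close>.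
  Take for \<open>A\<close>, \<open>B\<close> and \<open>M\<close> the stabilizers of \<open>w\<close>, of \<open>W\<close> and of the pair \<open>(x, X)\<close>. Then \<open>AM\<close>
  and \<open>BM\<close> are the stabilizers of \<open>X\<close> and \<open>x\<close>, and all orders follow from the orbit-stabilizer
  theorem. Since collineations act on the left, the right coset \<open>Ag\<close> is the set of group elements
  that map the point \<open>g\<^sup>-\<^sup>1 w\<close> to \<open>w\<close>, which gives the isomorphism with the coset plane.\<close>

section \<open>Finite projective planes\<close>

text \<open>The assumptions are self-dual: sizes of lines and of pencils are both required, so every
  result is also available with points and lines exchanged. Nondegeneracy is expressed by
  \<open>n > 1\<close> and nonemptiness instead of a quadrangle.\<close>

locale finite_plane =
  fixes P :: "'p set" and Q :: "'l set" and I :: "'p \<Rightarrow> 'l \<Rightarrow> bool" and n :: nat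
  assumes finite_P: "finite P" and finite_Q: "finite Q"
    and join: "\<lbrakk>p \<in> P; q \<in> P; p \<noteq> q\<rbrakk> \<Longrightarrow> \<exists>!l. l \<in> Q \<and> I p l \<and> I q l"
    and meet: "\<lbrakk>l \<in> Q; m \<in> Q; l \<noteq> m\<rbrakk> \<Longrightarrow> \<exists>!p. p \<in> P \<and> I p l \<and> I p m"
    and card_line: "l \<in> Q \<Longrightarrow> card {p \<in> P. I p l} = n + 1"
    and card_pencil: "p \<in> P \<Longrightarrow> card {l \<in> Q. I p l} = n + 1"
    and P_nonempty: "P \<noteq> {}" and Q_nonempty: "Q \<noteq> {}" and n_gt_1: "n > 1"
begin

section \<open>Duality and counting in a plane of order n\<close>

lemma dual_plane: "finite_plane Q P (\<lambda>l p. I p l) n"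
  by unfold_locales
    (use n_gt_1 in \<open>simp_all add: finite_P finite_Q join meet card_line card_pencil
      P_nonempty Q_nonempty\<close>)

lemma incident_unique:
  assumes "p \<in> P" "q \<in> P" "l \<in> Q" "m \<in> Q" "I p l" "I q l" "I p m" "I q m"
  shows "p = q \<or> l = m"
  using assms join by metis

text \<open>The lines through q partition the points other than q, so they cut S into disjoint
  pieces.\<close>

lemma card_eq_sum_pencil:
  assumes "q \<in> P" "S \<subseteq> P" "q \<notin> S"
  shows "card S = (\<Sum>l\<in>{l \<in> Q. I q l}. card {r \<in> S. I r l})"
proof -
  have "S = (\<Union>l\<in>{l \<in> Q. I q l}. {r \<in> S. I r l})"
    using assms join by fastforce
  moreover have "card (\<Union>l\<in>{l \<in> Q. I q l}. {r \<in> S. I r l}) =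
      (\<Sum>l\<in>{l \<in> Q. I q l}. card {r \<in> S. I r l})"
  proof (rule card_UN_disjoint)
    show "\<forall>l\<in>{l \<in> Q. I q l}. finite {r \<in> S. I r l}"
      using assms finite_P by (auto intro: finite_subset)
    show "\<forall>l\<in>{l \<in> Q. I q l}. \<forall>m\<in>{l \<in> Q. I q l}. l \<noteq> m \<longrightarrow>
        {r \<in> S. I r l} \<inter> {r \<in> S. I r m} = {}"
      using assms incident_unique by blast
  qed (use finite_Q in auto)
  ultimately show ?thesis by simp
qed

lemma card_P: "card P = n\<^sup>2 + n + 1"
proof -
  obtain q where q: "q \<in> P" using P_nonempty by blast
  have "card {r \<in> P - {q}. I r l} = n" if "l \<in> Q" "I q l" for l
  proof -
    have "{r \<in> P - {q}. I r l} = {r \<in> P. I r l} - {q}" by blast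
    then show ?thesis using that q finite_P card_line[of l] by (simp add: card_Diff_singleton)
  qed
  then have "card (P - {q}) = (n + 1) * n"
    using card_eq_sum_pencil[OF q, of "P - {q}"] card_pencil[OF q] by simp
  then show ?thesis
    using q finite_P card_Suc_Diff1[of P q] by (simp add: power2_eq_square)
qed

lemma card_off_line:
  assumes "L \<in> Q"
  shows "card {q \<in> P. \<not> I q L} = n\<^sup>2"
proof -
  have "{q \<in> P. \<not> I q L} = P - {q \<in> P. I q L}" by blast
  then show ?thesis
    using finite_P card_P card_line[OF assms] by (simp add: card_Diff_subset)
qed

text \<open>Of the n + 1 lines through q only the line joining q to p is lost.\<close>

lemma card_pencil_avoiding:
  assumes "p \<in> P" "q \<in> P" "p \<noteq> q"
  shows "card {l \<in> Q. I q l \<and> \<not> I p l} = n"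
proof -
  obtain m where m: "m \<in> Q" "I p m" "I q m" and
    uniq: "\<And>l. l \<in> Q \<Longrightarrow> I p l \<Longrightarrow> I q l \<Longrightarrow> l = m"
    using join[OF assms] by blast
  have "{l \<in> Q. I q l \<and> \<not> I p l} = {l \<in> Q. I q l} - {m}" using m uniq by blast
  then show ?thesis using m finite_Q card_pencil[OF assms(2)] by (simp add: card_Diff_singleton)
qed

text \<open>There are n^2 choices for q off L; each such q differs from p, which is on L, so n of
  its lines avoid p.\<close>

lemma card_opposite:
  assumes "p \<in> P" "L \<in> Q" "I p L"
  shows "card {(q, l). q \<in> P \<and> l \<in> Q \<and> I q l \<and> \<not> I q L \<and> \<not> I p l} = n ^ 3"
proof -
  have "{(q, l). q \<in> P \<and> l \<in> Q \<and> I q l \<and> \<not> I q L \<and> \<not> I p l} =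
      (SIGMA q : {q \<in> P. \<not> I q L}. {l \<in> Q. I q l \<and> \<not> I p l})" by auto
  also have "card \<dots> = (\<Sum>q\<in>{q \<in> P. \<not> I q L}. card {l \<in> Q. I q l \<and> \<not> I p l})"
    using finite_P finite_Q by (intro card_SigmaI) auto
  also have "\<dots> = (\<Sum>q\<in>{q \<in> P. \<not> I q L}. n)"
    using assms by (intro sum.cong card_pencil_avoiding) auto
  also have "\<dots> = n ^ 3"
    using card_off_line[OF assms(2)] by (simp add: power3_eq_cube power2_eq_square)
  finally show ?thesis .
qed

lemma two_points_on_line:
  assumes "l \<in> Q"
  obtains q r where "q \<in> P" "r \<in> P" "q \<noteq> r" "I q l" "I r l"
proof -
  have "\<not> card {p \<in> P. I p l} \<le> Suc 0"
    using card_line[OF assms] n_gt_1 by simp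
  then show ?thesis using that finite_P by (auto simp: card_le_Suc0_iff_eq)
qed

text \<open>The complement C of P' has n + 1 points, and a line of Q' meets it in exactly (n + 1) -
  n = 1 point. So the line L joining two points of C is not in Q'. If L carried a point q of P', the
  n lines of Q' through q would account for n points of C and L for at least two more, which exceeds
  n + 1. Hence all n + 1 points of L are in C, and they exhaust it.\<close>

lemma complement_eq_line:
  assumes P': "P' \<subseteq> P" "card P' = n\<^sup>2" and Q': "Q' \<subseteq> Q"
    and line: "\<And>l. l \<in> Q' \<Longrightarrow> card {q \<in> P'. I q l} = n"
    and pencil: "\<And>q. q \<in> P' \<Longrightarrow> card {l \<in> Q'. I q l} = n"
  obtains L where "L \<in> Q - Q'" "P' = {q \<in> P. \<not> I q L}"
proof -
  have card_C: "card (P - P') = n + 1"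
    using P' card_P finite_P by (simp add: card_Diff_subset finite_subset)
  then have "\<not> card (P - P') \<le> Suc 0" using n_gt_1 by simp
  then obtain c d where cd: "c \<in> P - P'" "d \<in> P - P'" "c \<noteq> d"
    using finite_P by (auto simp: card_le_Suc0_iff_eq)
  then obtain L where L: "L \<in> Q" "I c L" "I d L" using join by (metis DiffD1)
  have two: "2 \<le> card {q \<in> P - P'. I q L}"
  proof -
    have "card {c, d} \<le> card {q \<in> P - P'. I q L}"
      using cd L finite_P by (intro card_mono) auto
    then show ?thesis using cd by simp
  qed
  have one: "card {q \<in> P - P'. I q l} = 1" if "l \<in> Q'" for l
  proof -
    have "{q \<in> P - P'. I q l} = {q \<in> P. I q l} - {q \<in> P'. I q l}" by blast
    moreover have "card ({q \<in> P. I q l} - {q \<in> P'. I q l}) =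
        card {q \<in> P. I q l} - card {q \<in> P'. I q l}"
      using P' finite_P by (intro card_Diff_subset) (auto intro: finite_subset)
    ultimately show ?thesis using that Q' card_line[of l] line[OF that] by auto
  qed
  have "L \<notin> Q'" using one two by fastforce
  have off: "\<not> I q L" if q: "q \<in> P'" for q
  proof
    assume "I q L"
    have fin: "finite {l \<in> Q'. I q l}" using Q' finite_Q by (auto intro: finite_subset)
    have "(\<Sum>l\<in>insert L {l \<in> Q'. I q l}. card {r \<in> P - P'. I r l})
        \<le> (\<Sum>l\<in>{l \<in> Q. I q l}. card {r \<in> P - P'. I r l})"
      using Q' L \<open>I q L\<close> finite_Q by (intro sum_mono2) auto
    also have "\<dots> = n + 1"
      using card_eq_sum_pencil[of q "P - P'"] q P' card_C by auto
    finally show False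
      using two fin \<open>L \<notin> Q'\<close> one pencil[OF q] by simp
  qed
  have "{q \<in> P. I q L} = P - P'"
    using off card_C card_line[OF L(1)] finite_P by (intro card_subset_eq) auto
  then show ?thesis using that[of L] L \<open>L \<notin> Q'\<close> P' by blast
qed

end

text \<open>The case a = n + 1 fails because n + 1 is coprime to n^3; the case a < n fails because
  (n^2 + n + 1)(n - 1) = n^3 - 1.\<close>

lemma mult_eq_cube:
  fixes n :: nat
  assumes "n > 1" "m * a = n ^ 3" "a \<le> n + 1" "m \<le> n\<^sup>2 + n + 1"
  shows "a = n \<and> m = n\<^sup>2"
proof -
  have "a \<noteq> n + 1"
  proof
    assume "a = n + 1"
    then have "n + 1 dvd n ^ 3" using assms(2) by (metis dvd_triv_right)
    moreover have "coprime (n + 1) (n ^ 3)" by simp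
    ultimately have "n + 1 = 1" using coprime_common_divisor_nat[of "n+1" "n^3" "n+1"] by auto
    then show False using assms(1) by simp
  qed
  moreover have "\<not> a < n"
  proof
    assume "a < n"
    then obtain b where n: "n = Suc b" and b: "a \<le> b" by (metis Suc_pred' less_Suc_eq_le less_nat_zero_code not_gr_zero)
    have "n ^ 3 \<le> (n\<^sup>2 + n + 1) * b" using assms(2,4) b by (metis mult_le_mono)
    then show False by (simp add: n power2_eq_square power3_eq_cube algebra_simps)
  qed
  ultimately have "a = n" using assms(3) by simp
  then show ?thesis using assms(1,2) by (simp add: power2_eq_square power3_eq_cube)
qed

section \<open>From the quadrangle axiom to the order of a plane\<close>

lemma projective_plane_quadrangle:
  assumes "projective_plane \<pi>"
  obtains a b c d where "{a, b, c, d} \<subseteq> points \<pi>" "distinct [a, b, c, d]"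
    "\<And>l r s t. \<lbrakk>l \<in> lines \<pi>; r \<in> {a,b,c,d}; s \<in> {a,b,c,d}; t \<in> {a,b,c,d}; distinct [r, s, t];
      incident \<pi> r l; incident \<pi> s l; incident \<pi> t l\<rbrakk> \<Longrightarrow> False"
proof -
  obtain R where R: "R \<subseteq> points \<pi>" "card R = 4"
    and non: "\<forall>T\<subseteq>R. card T = 3 \<longrightarrow> \<not> (\<exists>l\<in>lines \<pi>. \<forall>p\<in>T. incident \<pi> p l)"
    using assms unfolding projective_plane_def by (elim conjE exE)
  obtain xs where xs: "set xs = R" "distinct xs" "length xs = 4"
    using R(2) by (metis card.infinite distinct_card finite_distinct_list zero_neq_numeral)
  then obtain a b c d where "xs = [a, b, c, d]"
    by (auto simp: numeral_eq_Suc length_Suc_conv)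
  then have abcd: "R = {a, b, c, d}" "distinct [a, b, c, d]" using xs by auto
  have False if "l \<in> lines \<pi>" "r \<in> R" "s \<in> R" "t \<in> R" "distinct [r, s, t]"
    "incident \<pi> r l" "incident \<pi> s l" "incident \<pi> t l" for l r s t
  proof -
    have "{r, s, t} \<subseteq> R" "card {r, s, t} = 3" using that by auto
    then show ?thesis using non that(1,6-8) by blast
  qed
  then show ?thesis using that[of a b c d] R abcd by blast
qed

text \<open>Projection from q: sending a line through q to its intersection with l is a
  bijection.\<close>

lemma card_pencil_eq_card_line:
  assumes "projective_plane \<pi>" "q \<in> points \<pi>" "l \<in> lines \<pi>" "\<not> incident \<pi> q l"
  shows "card {m \<in> lines \<pi>. incident \<pi> q m} = card {r \<in> points \<pi>. incident \<pi> r l}"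
proof -
  have join: "\<exists>!m. m \<in> lines \<pi> \<and> incident \<pi> q m \<and> incident \<pi> r m"
    if "r \<in> points \<pi>" "incident \<pi> r l" for r
    using assms that unfolding projective_plane_def by metis
  have meet: "\<exists>!r. r \<in> points \<pi> \<and> incident \<pi> r m \<and> incident \<pi> r l"
    if "m \<in> lines \<pi>" "incident \<pi> q m" for m
    using assms that unfolding projective_plane_def by metis
  define f where "f m = (THE r. r \<in> points \<pi> \<and> incident \<pi> r m \<and> incident \<pi> r l)" for m
  have f: "f m \<in> points \<pi>" "incident \<pi> (f m) m" "incident \<pi> (f m) l"
    if "m \<in> lines \<pi>" "incident \<pi> q m" for m
    using theI'[OF meet[OF that]] unfolding f_def by auto
  have "bij_betw f {m \<in> lines \<pi>. incident \<pi> q m} {r \<in> points \<pi>. incident \<pi> r l}"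
  proof (rule bij_betw_imageI)
    show "inj_on f {m \<in> lines \<pi>. incident \<pi> q m}"
      using f join by (auto simp: inj_on_def) metis
    have "r \<in> f ` {m \<in> lines \<pi>. incident \<pi> q m}" if "r \<in> points \<pi>" "incident \<pi> r l" for r
      using join[OF that] meet f that by (metis (mono_tags, lifting) image_eqI mem_Collect_eq)
    then show "f ` {m \<in> lines \<pi>. incident \<pi> q m} = {r \<in> points \<pi>. incident \<pi> r l}"
      using f by auto
  qed
  then show ?thesis by (rule bij_betw_same_card)
qed

text \<open>Some vertex of the quadrangle is off l. The lines from it to the other three vertices
  are distinct, since no three vertices are collinear, and so they meet l in three distinct
  points.\<close>

lemma three_points_on_line:
  assumes "projective_plane \<pi>" "l \<in> lines \<pi>"
  obtains x y z where "{x, y, z} \<subseteq> {r \<in> points \<pi>. incident \<pi> r l}" "distinct [x, y, z]"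
proof -
  note thesis_rule = that
  have join: "\<exists>m. m \<in> lines \<pi> \<and> incident \<pi> q m \<and> incident \<pi> r m"
    if "r \<in> points \<pi>" "q \<in> points \<pi>" "r \<noteq> q" for r q
    using assms that unfolding projective_plane_def by metis
  have meet: "\<exists>r. r \<in> points \<pi> \<and> incident \<pi> r m \<and> incident \<pi> r l"
    if "m \<in> lines \<pi>" "m \<noteq> l" for m
    using assms that unfolding projective_plane_def by metis
  have uniq: "q = r \<or> m = m'" if "q \<in> points \<pi>" "r \<in> points \<pi>" "m \<in> lines \<pi>" "m' \<in> lines \<pi>"
    "incident \<pi> q m" "incident \<pi> r m" "incident \<pi> q m'" "incident \<pi> r m'" for q r m m'
    using assms(1) that unfolding projective_plane_def by metis
  \<comment> \<open>Stated for any ordering of the quadrangle, so that whichever vertex is off l can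
    take the place of a.\<close>
  have *: thesis if abcd: "{a, b, c, d} \<subseteq> points \<pi>" "distinct [a, b, c, d]"
    "\<And>l r s t. \<lbrakk>l \<in> lines \<pi>; r \<in> {a,b,c,d}; s \<in> {a,b,c,d}; t \<in> {a,b,c,d}; distinct [r, s, t];
      incident \<pi> r l; incident \<pi> s l; incident \<pi> t l\<rbrakk> \<Longrightarrow> False"
    and a: "\<not> incident \<pi> a l" for a b c d
  proof -
    obtain mb where mb: "mb \<in> lines \<pi>" "incident \<pi> a mb" "incident \<pi> b mb"
      using join[of b a] abcd(1,2) by auto
    obtain mc where mc: "mc \<in> lines \<pi>" "incident \<pi> a mc" "incident \<pi> c mc"
      using join[of c a] abcd(1,2) by auto
    obtain md where md: "md \<in> lines \<pi>" "incident \<pi> a md" "incident \<pi> d md"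
      using join[of d a] abcd(1,2) by auto
    have ne: "mb \<noteq> mc" "mb \<noteq> md" "mc \<noteq> md"
      using abcd(3)[of mb a b c] abcd(3)[of mb a b d] abcd(3)[of mc a c d] mb mc md abcd(2) by auto
    obtain x where x: "x \<in> points \<pi>" "incident \<pi> x mb" "incident \<pi> x l" using meet mb a by metis
    obtain y where y: "y \<in> points \<pi>" "incident \<pi> y mc" "incident \<pi> y l" using meet mc a by metis
    obtain z where z: "z \<in> points \<pi>" "incident \<pi> z md" "incident \<pi> z l" using meet md a by metis
    have "a \<in> points \<pi>" using abcd by simp
    then have "distinct [x, y, z]"
      using uniq[of a x mb mc] uniq[of a x mb md] uniq[of a y mc md] x y z a mb mc md ne by auto
    then show thesis using thesis_rule x y z by auto
  qed
  obtain a b c d where abcd: "{a, b, c, d} \<subseteq> points \<pi>" "distinct [a, b, c, d]"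
    and no: "\<And>l r s t. \<lbrakk>l \<in> lines \<pi>; r \<in> {a,b,c,d}; s \<in> {a,b,c,d}; t \<in> {a,b,c,d}; distinct [r, s, t];
      incident \<pi> r l; incident \<pi> s l; incident \<pi> t l\<rbrakk> \<Longrightarrow> False"
    using projective_plane_quadrangle[OF assms(1)] by blast
  have "\<not> incident \<pi> a l \<or> \<not> incident \<pi> b l \<or> \<not> incident \<pi> c l"
    using no[of l a b c] assms(2) abcd by auto
  then show thesis
  proof (elim disjE)
    assume "\<not> incident \<pi> a l"
    with *[of a b c d] abcd no show thesis by blast
  next
    assume b: "\<not> incident \<pi> b l"
    have eq: "{b, a, c, d} = {a, b, c, d}" by blast
    show thesis by (rule *[of b a c d, unfolded eq]) (use abcd no b in auto)
  next
    assume c: "\<not> incident \<pi> c l"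
    have eq: "{c, a, b, d} = {a, b, c, d}" by blast
    show thesis by (rule *[of c a b d, unfolded eq]) (use abcd no c in auto)
  qed
qed

text \<open>Join a point x of l off m to a point y of m off l. The joining line meets l only in x
  and m only in y, so any third point on it is off both.\<close>

lemma point_off_two_lines:
  assumes "projective_plane \<pi>" "l \<in> lines \<pi>" "m \<in> lines \<pi>" "l \<noteq> m"
  obtains q where "q \<in> points \<pi>" "\<not> incident \<pi> q l" "\<not> incident \<pi> q m"
proof -
  have uniq: "q = r \<or> k = k'" if "q \<in> points \<pi>" "r \<in> points \<pi>" "k \<in> lines \<pi>" "k' \<in> lines \<pi>"
    "incident \<pi> q k" "incident \<pi> r k" "incident \<pi> q k'" "incident \<pi> r k'" for q r k k'
    using assms(1) that unfolding projective_plane_def by metis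
  have off: "\<exists>x\<in>points \<pi>. incident \<pi> x k \<and> \<not> incident \<pi> x k'"
    if k: "k \<in> lines \<pi>" "k' \<in> lines \<pi>" "k \<noteq> k'" for k k'
  proof -
    obtain x y z where "{x, y, z} \<subseteq> {r \<in> points \<pi>. incident \<pi> r k}" "distinct [x, y, z]"
      using three_points_on_line[OF assms(1) k(1)] .
    then show ?thesis using uniq[of x y k k'] k by auto
  qed
  obtain x where x: "x \<in> points \<pi>" "incident \<pi> x l" "\<not> incident \<pi> x m"
    using off assms by blast
  obtain y where y: "y \<in> points \<pi>" "incident \<pi> y m" "\<not> incident \<pi> y l"
    using off assms by blast
  obtain k where k: "k \<in> lines \<pi>" "incident \<pi> x k" "incident \<pi> y k"
    using assms(1) x y unfolding projective_plane_def by metis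
  obtain u v w where uvw: "{u, v, w} \<subseteq> {r \<in> points \<pi>. incident \<pi> r k}" "distinct [u, v, w]"
    using three_points_on_line[OF assms(1) k(1)] .
  then obtain z where z: "z \<in> points \<pi>" "incident \<pi> z k" "z \<noteq> x" "z \<noteq> y" by auto
  show thesis
    using that[of z] z uniq[of z x k l] uniq[of z y k m] x y k assms by blast
qed

text \<open>Two lines have equally many points because both correspond to the pencil of a point off
  both. The order is one less than this number, and three points on a line make it exceed 1.\<close>

lemma finite_projective_plane_order:
  assumes "finite_projective_plane \<pi>"
  obtains n where "n > 1" "has_plane_order \<pi> n"
proof -
  have \<pi>: "projective_plane \<pi>" "finite (points \<pi>)"
    using assms by (simp_all add: finite_projective_plane_def)
  obtain a b c d where abcd: "{a, b, c, d} \<subseteq> points \<pi>" "distinct [a, b, c, d]"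
    using projective_plane_quadrangle[OF \<pi>(1)] by metis
  then obtain l where l: "l \<in> lines \<pi>"
    using \<pi>(1) unfolding projective_plane_def by (metis distinct_length_2_or_more insert_subset)
  let ?N = "card {r \<in> points \<pi>. incident \<pi> r l}"
  obtain x y z where xyz: "{x, y, z} \<subseteq> {r \<in> points \<pi>. incident \<pi> r l}" "distinct [x, y, z]"
    using three_points_on_line[OF \<pi>(1) l] .
  have "card {x, y, z} \<le> ?N"
    using xyz \<pi>(2) by (intro card_mono) auto
  then have N: "3 \<le> ?N" using xyz(2) by simp
  have "card {r \<in> points \<pi>. incident \<pi> r m} = ?N" if m: "m \<in> lines \<pi>" for m
  proof (cases "m = l")
    case False
    then obtain q where "q \<in> points \<pi>" "\<not> incident \<pi> q l" "\<not> incident \<pi> q m"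
      using point_off_two_lines[OF \<pi>(1) l m] by metis
    then show ?thesis
      using card_pencil_eq_card_line[OF \<pi>(1), of q] l m by metis
  qed simp
  then show thesis
    using N by (intro that[of "?N - 1"]) (auto simp: has_plane_order_def)
qed

text \<open>The size of a pencil is found by projecting from its point onto a line that misses it.
  Such a line exists among the sides of the triangle abc, since these are not concurrent.\<close>

lemma finite_plane_of_projective_plane:
  assumes "finite_projective_plane \<pi>" "has_plane_order \<pi> n" "n > 1"
  shows "finite_plane (points \<pi>) (lines \<pi>) (incident \<pi>) n"
proof -
  have \<pi>: "projective_plane \<pi>" "finite (points \<pi>)" "finite (lines \<pi>)"
    using assms by (simp_all add: finite_projective_plane_def)
  obtain a b c d where abcd: "{a, b, c, d} \<subseteq> points \<pi>" "distinct [a, b, c, d]"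
    and no: "\<And>l r s t. \<lbrakk>l \<in> lines \<pi>; r \<in> {a,b,c,d}; s \<in> {a,b,c,d}; t \<in> {a,b,c,d}; distinct [r, s, t];
      incident \<pi> r l; incident \<pi> s l; incident \<pi> t l\<rbrakk> \<Longrightarrow> False"
    using projective_plane_quadrangle[OF \<pi>(1)] by metis
  have join: "\<exists>!l. l \<in> lines \<pi> \<and> incident \<pi> p l \<and> incident \<pi> q l"
    if "p \<in> points \<pi>" "q \<in> points \<pi>" "p \<noteq> q" for p q
    using \<pi>(1) that unfolding projective_plane_def by metis
  have off: "\<exists>l\<in>lines \<pi>. \<not> incident \<pi> q l" if q: "q \<in> points \<pi>" for q
  proof -
    obtain l where l: "l \<in> lines \<pi>" "incident \<pi> a l" "incident \<pi> b l" using join[of a b] abcd by auto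
    obtain m where m: "m \<in> lines \<pi>" "incident \<pi> a m" "incident \<pi> c m" using join[of a c] abcd by auto
    obtain k where k: "k \<in> lines \<pi>" "incident \<pi> b k" "incident \<pi> c k" using join[of b c] abcd by auto
    have "l \<noteq> m" using no[of l a b c] l m abcd by auto
    moreover have "\<not> incident \<pi> a k" using no[of k a b c] k abcd by auto
    moreover have "a \<in> points \<pi>" using abcd by simp
    ultimately show ?thesis using join[of a q] l m k q by metis
  qed
  show ?thesis
  proof unfold_locales
    show "card {p \<in> points \<pi>. incident \<pi> p l} = n + 1" if "l \<in> lines \<pi>" for l
      using assms(2) that by (simp add: has_plane_order_def)
    then show "card {l \<in> lines \<pi>. incident \<pi> p l} = n + 1" if "p \<in> points \<pi>" for p
      using off[OF that] card_pencil_eq_card_line[OF \<pi>(1) that] by metis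
    show "\<exists>!p. p \<in> points \<pi> \<and> incident \<pi> p l \<and> incident \<pi> p m"
      if "l \<in> lines \<pi>" "m \<in> lines \<pi>" "l \<noteq> m" for l m
      using \<pi>(1) that unfolding projective_plane_def by metis
    show "points \<pi> \<noteq> {}" using abcd by auto
    then show "lines \<pi> \<noteq> {}" using off by auto
  qed (use \<pi> join assms(3) in auto)
qed

section \<open>Group actions and cubic flag orbits\<close>

context group_action
begin

sublocale group G
  using group_hom by (rule group_hom.axioms(1))

lemma inv_act [simp]: "\<lbrakk>g \<in> carrier G; x \<in> E\<rbrakk> \<Longrightarrow> \<phi> (inv g) (\<phi> g x) = x"
  using orbit_sym_aux by blast

lemma act_closed [simp]: "\<lbrakk>g \<in> carrier G; x \<in> E\<rbrakk> \<Longrightarrow> \<phi> g x \<in> E"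
  using element_image by blast

lemma act_inv [simp]: "\<lbrakk>g \<in> carrier G; x \<in> E\<rbrakk> \<Longrightarrow> \<phi> g (\<phi> (inv g) x) = x"
  using inv_act[of "inv g" x] by simp

lemma act_inj: "\<lbrakk>\<phi> g x = \<phi> g y; g \<in> carrier G; x \<in> E; y \<in> E\<rbrakk> \<Longrightarrow> x = y"
  by (metis inv_act)

lemma orbit_subset: "x \<in> E \<Longrightarrow> orbit G \<phi> x \<subseteq> E"
  by (auto simp: orbit_def)

lemma act_mem_orbit_iff:
  assumes "x \<in> E" "y \<in> E" "g \<in> carrier G"
  shows "\<phi> g y \<in> orbit G \<phi> x \<longleftrightarrow> y \<in> orbit G \<phi> x"
proof
  assume "y \<in> orbit G \<phi> x"
  then show "\<phi> g y \<in> orbit G \<phi> x"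
    using assms orbit_trans[of x y "\<phi> g y"] by (auto simp: orbit_def)
next
  assume "\<phi> g y \<in> orbit G \<phi> x"
  moreover have "y \<in> orbit G \<phi> (\<phi> g y)"
    using assms inv_act[of g y] unfolding orbit_def by (metis (mono_tags, lifting) inv_closed mem_Collect_eq)
  ultimately show "y \<in> orbit G \<phi> x"
    using assms orbit_trans[of x "\<phi> g y" y] by auto
qed

text \<open>For a left action, g and a agree on y iff \<open>g \<otimes> inv a\<close> fixes the
  image of y under a. So the elements with a prescribed value at y form a right coset of the
  stabilizer of that value.\<close>

lemma rcoset_stabilizer:
  assumes "y \<in> E" "a \<in> carrier G"
  shows "stabilizer G \<phi> (\<phi> a y) #> a = {g \<in> carrier G. \<phi> g y = \<phi> a y}"
proof
  show "stabilizer G \<phi> (\<phi> a y) #> a \<subseteq> {g \<in> carrier G. \<phi> g y = \<phi> a y}"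
    using assms by (auto simp: r_coset_def stabilizer_def composition_rule)
  show "{g \<in> carrier G. \<phi> g y = \<phi> a y} \<subseteq> stabilizer G \<phi> (\<phi> a y) #> a"
  proof clarify
    fix g assume g: "g \<in> carrier G" "\<phi> g y = \<phi> a y"
    then have "g \<otimes> inv a \<in> stabilizer G \<phi> (\<phi> a y)"
      using assms by (simp add: stabilizer_def composition_rule)
    moreover have "g = g \<otimes> inv a \<otimes> a" using g assms by (simp add: m_assoc)
    ultimately show "g \<in> stabilizer G \<phi> (\<phi> a y) #> a" unfolding r_coset_def by blast
  qed
qed

text \<open>This labels the points and lines by right cosets. Each y is sent to the elements that
  carry it to x; one element carrying both y and z to x forces y = z, and the coset of a belongs to
  the preimage of x under a.\<close>

lemma bij_betw_orbit_rcosets: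
  assumes "x \<in> E"
  shows "bij_betw (\<lambda>y. {g \<in> carrier G. \<phi> g y = x}) (orbit G \<phi> x) (rcosets (stabilizer G \<phi> x))"
proof (rule bij_betw_imageI)
  have ret: "\<exists>a\<in>carrier G. \<phi> a y = x" if "y \<in> orbit G \<phi> x" for y
    using that assms inv_act inv_closed unfolding orbit_def by blast
  show "inj_on (\<lambda>y. {g \<in> carrier G. \<phi> g y = x}) (orbit G \<phi> x)"
  proof (rule inj_onI)
    fix y z assume yz: "y \<in> orbit G \<phi> x" "z \<in> orbit G \<phi> x"
      and eq: "{g \<in> carrier G. \<phi> g y = x} = {g \<in> carrier G. \<phi> g z = x}"
    obtain a where a: "a \<in> carrier G" "\<phi> a y = x" using ret yz by blast
    then have "\<phi> a z = x" using eq by blast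
    then show "y = z" using act_inj[of a y z] a yz orbit_subset[OF assms] by auto
  qed
  show "(\<lambda>y. {g \<in> carrier G. \<phi> g y = x}) ` orbit G \<phi> x = rcosets (stabilizer G \<phi> x)"
  proof
    show "(\<lambda>y. {g \<in> carrier G. \<phi> g y = x}) ` orbit G \<phi> x \<subseteq> rcosets (stabilizer G \<phi> x)"
    proof clarify
      fix y assume y: "y \<in> orbit G \<phi> x"
      then obtain a where a: "a \<in> carrier G" "\<phi> a y = x" using ret by blast
      then show "{g \<in> carrier G. \<phi> g y = x} \<in> rcosets (stabilizer G \<phi> x)"
        using rcoset_stabilizer[of y a] y orbit_subset[OF assms] unfolding RCOSETS_def by auto
    qed
    show "rcosets (stabilizer G \<phi> x) \<subseteq> (\<lambda>y. {g \<in> carrier G. \<phi> g y = x}) ` orbit G \<phi> x"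
    proof
      fix R assume "R \<in> rcosets (stabilizer G \<phi> x)"
      then obtain a where a: "a \<in> carrier G" "R = stabilizer G \<phi> x #> a"
        unfolding RCOSETS_def by blast
      then have "R = {g \<in> carrier G. \<phi> g (\<phi> (inv a) x) = x}"
        using rcoset_stabilizer[of "\<phi> (inv a) x" a] assms by simp
      moreover have "\<phi> (inv a) x \<in> orbit G \<phi> x" using a unfolding orbit_def by auto
      ultimately show "R \<in> (\<lambda>y. {g \<in> carrier G. \<phi> g y = x}) ` orbit G \<phi> x" by blast
    qed
  qed
qed

end

text \<open>Used for the orbit-stabilizer theorem on point-line pairs. Restriction makes the product
  maps extensional, as \<open>Bij\<close> demands.\<close>

lemma group_action_Times:
  assumes "group_action G E \<phi>" "group_action G F \<psi>"
  shows "group_action G (E \<times> F) (\<lambda>g. restrict (map_prod (\<phi> g) (\<psi> g)) (E \<times> F))"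
proof -
  interpret E: group_action G E \<phi> by fact
  interpret F: group_action G F \<psi> by fact
  have Bij: "restrict (map_prod (\<phi> g) (\<psi> g)) (E \<times> F) \<in> Bij (E \<times> F)" if g: "g \<in> carrier G" for g
  proof -
    have "bij_betw (map_prod (\<phi> g) (\<psi> g)) (E \<times> F) (E \<times> F)"
      using E.bij_prop0[OF g] F.bij_prop0[OF g]
      by (auto simp: Bij_def intro!: bij_betw_map_prod)
    then show ?thesis by (simp add: Bij_def cong: bij_betw_cong)
  qed
  have "restrict (map_prod (\<phi> (g \<otimes>\<^bsub>G\<^esub> h)) (\<psi> (g \<otimes>\<^bsub>G\<^esub> h))) (E \<times> F) =
      compose (E \<times> F) (restrict (map_prod (\<phi> g) (\<psi> g)) (E \<times> F))
        (restrict (map_prod (\<phi> h) (\<psi> h)) (E \<times> F))"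
    if "g \<in> carrier G" "h \<in> carrier G" for g h
    using that by (auto simp: fun_eq_iff compose_def restrict_def E.composition_rule F.composition_rule)
  then show ?thesis
    using Bij unfolding group_action_def group_hom_def group_hom_axioms_def
    by (intro conjI E.is_group group_BijGroup homI) (simp_all add: BijGroup_def)
qed

section \<open>Groups acting on a plane and their flag orbits of size n^3\<close>

locale plane_action = finite_plane P Q I n + pt: group_action G P \<phi> + ln: group_action G Q \<psi>
  for P :: "'p set" and Q :: "'l set" and I n and G (structure) and \<phi> \<psi> +
  assumes finite_carrier: "finite (carrier G)"
    and incident_act [simp]: "\<lbrakk>g \<in> carrier G; q \<in> P; l \<in> Q\<rbrakk> \<Longrightarrow> I (\<phi> g q) (\<psi> g l) \<longleftrightarrow> I q l"
begin

lemma dual_action: "plane_action Q P (\<lambda>l p. I p l) n G \<psi> \<phi>"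
  using dual_plane ln.group_action_axioms pt.group_action_axioms finite_carrier
  by (simp add: plane_action_def plane_action_axioms_def)

lemma card_degree_act:
  assumes "w \<in> P" "W \<in> Q" "g \<in> carrier G"
  shows "card {l \<in> orbit G \<psi> W. I (\<phi> g w) l} = card {l \<in> orbit G \<psi> W. I w l}"
proof -
  have sub: "orbit G \<psi> W \<subseteq> Q" using assms ln.orbit_subset by blast
  have "{l \<in> orbit G \<psi> W. I (\<phi> g w) l} = \<psi> g ` {l \<in> orbit G \<psi> W. I w l}"
  proof
    show "\<psi> g ` {l \<in> orbit G \<psi> W. I w l} \<subseteq> {l \<in> orbit G \<psi> W. I (\<phi> g w) l}"
      using assms sub by (auto simp: ln.act_mem_orbit_iff)
    show "{l \<in> orbit G \<psi> W. I (\<phi> g w) l} \<subseteq> \<psi> g ` {l \<in> orbit G \<psi> W. I w l}"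
    proof clarify
      fix l assume l: "l \<in> orbit G \<psi> W" "I (\<phi> g w) l"
      then have "l = \<psi> g (\<psi> (inv g) l)" "\<psi> (inv g) l \<in> orbit G \<psi> W"
        using assms sub by (auto simp: ln.act_mem_orbit_iff)
      moreover from this have "I w (\<psi> (inv g) l)"
        using l assms incident_act[of g w "\<psi> (inv g) l"] sub by auto
      ultimately show "l \<in> \<psi> g ` {l \<in> orbit G \<psi> W. I w l}" by blast
    qed
  qed
  moreover have "inj_on (\<psi> g) {l \<in> orbit G \<psi> W. I w l}"
    using sub by (intro inj_on_subset[OF ln.inj_prop[OF assms(3)]]) auto
  ultimately show ?thesis by (simp add: card_image)
qed

text \<open>Let F q be the set of lines forming a flag of the orbit with q. Its size is constant on
  the point orbit, so counting the flags by their points gives a factorization of n^3 to which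
  \<open>mult_eq_cube\<close> applies. As F q is only known to be contained in the set of lines of
  the line orbit through q, the degree c may still be n or n + 1.\<close>

lemma cubic_flag_orbit_point_orbit:
  assumes w: "w \<in> P" "W \<in> Q" "I w W"
    and card: "card {(\<phi> g w, \<psi> g W) |g. g \<in> carrier G} = n ^ 3"
  shows "card (orbit G \<phi> w) = n\<^sup>2"
    and "\<exists>c\<in>{n, n + 1}. \<forall>q\<in>orbit G \<phi> w. card {l \<in> orbit G \<psi> W. I q l} = c"
proof -
  define Fl where "Fl = {(\<phi> g w, \<psi> g W) |g. g \<in> carrier G}"
  define F where "F q = {l. (q, l) \<in> Fl}" for q
  have sub: "orbit G \<phi> w \<subseteq> P" "orbit G \<psi> W \<subseteq> Q"
    using w pt.orbit_subset ln.orbit_subset by auto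
  have F_sub: "F q \<subseteq> {l \<in> orbit G \<psi> W. I q l}" for q
    using w by (auto simp: F_def Fl_def orbit_def)
  have fin: "finite (F q)" for q
    using finite_subset[OF F_sub] sub(2) finite_Q by (auto intro: finite_subset)
  have Fl_act: "(\<phi> h q, \<psi> h l) \<in> Fl" if ql: "(q, l) \<in> Fl" and h: "h \<in> carrier G" for q l h
  proof -
    obtain g where g: "g \<in> carrier G" "q = \<phi> g w" "l = \<psi> g W"
      using ql by (auto simp: Fl_def)
    then have "\<phi> h q = \<phi> (h \<otimes> g) w" "\<psi> h l = \<psi> (h \<otimes> g) W"
      using w h by (simp_all add: pt.composition_rule ln.composition_rule)
    moreover have "h \<otimes> g \<in> carrier G" using g(1) h by simp
    ultimately show ?thesis unfolding Fl_def by blast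
  qed
  have F_act: "card (F (\<phi> g w)) = card (F w)" if g: "g \<in> carrier G" for g
  proof -
    have "F (\<phi> g w) = \<psi> g ` F w"
    proof
      show "\<psi> g ` F w \<subseteq> F (\<phi> g w)" using Fl_act g by (auto simp: F_def)
      show "F (\<phi> g w) \<subseteq> \<psi> g ` F w"
      proof
        fix l assume l: "l \<in> F (\<phi> g w)"
        then have "\<psi> (inv g) l \<in> F w"
          using Fl_act[of "\<phi> g w" l "inv g"] g w by (simp add: F_def)
        moreover have "l \<in> Q" using l F_sub[of "\<phi> g w"] sub by blast
        then have "l = \<psi> g (\<psi> (inv g) l)" using g by simp
        ultimately show "l \<in> \<psi> g ` F w" by blast
      qed
    qed
    moreover have "inj_on (\<psi> g) (F w)"
      using F_sub[of w] sub by (intro inj_on_subset[OF ln.inj_prop[OF g]]) auto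
    ultimately show ?thesis by (simp add: card_image)
  qed
  have "Fl = (SIGMA q : orbit G \<phi> w. F q)"
    by (auto simp: F_def Fl_def orbit_def)
  then have "n ^ 3 = card (SIGMA q : orbit G \<phi> w. F q)" using card by (simp add: Fl_def)
  also have "\<dots> = (\<Sum>q\<in>orbit G \<phi> w. card (F q))"
    using fin finite_subset[OF sub(1) finite_P] by (intro card_SigmaI) auto
  also have "\<dots> = (\<Sum>q\<in>orbit G \<phi> w. card (F w))"
    using F_act by (intro sum.cong) (auto simp: orbit_def)
  finally have prod: "card (orbit G \<phi> w) * card (F w) = n ^ 3" by simp
  have deg: "card (F w) \<le> card {l \<in> orbit G \<psi> W. I w l}"
    using F_sub sub finite_subset[OF sub(2) finite_Q] by (intro card_mono) auto
  have deg': "card {l \<in> orbit G \<psi> W. I w l} \<le> n + 1"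
  proof -
    have "card {l \<in> orbit G \<psi> W. I w l} \<le> card {l \<in> Q. I w l}"
      using sub finite_Q by (intro card_mono) auto
    then show ?thesis using card_pencil w by simp
  qed
  have "card (orbit G \<phi> w) \<le> n\<^sup>2 + n + 1"
    using card_mono[OF finite_P sub(1)] card_P by simp
  then have *: "card (F w) = n" "card (orbit G \<phi> w) = n\<^sup>2"
    using mult_eq_cube[OF n_gt_1 prod] deg deg' by auto
  show "card (orbit G \<phi> w) = n\<^sup>2" by fact
  have "card {l \<in> orbit G \<psi> W. I w l} \<in> {n, n + 1}" using * deg deg' by auto
  moreover have "card {l \<in> orbit G \<psi> W. I q l} = card {l \<in> orbit G \<psi> W. I w l}"
    if "q \<in> orbit G \<phi> w" for q
    using that card_degree_act[OF w(1,2)] by (auto simp: orbit_def)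
  ultimately show "\<exists>c\<in>{n, n + 1}. \<forall>q\<in>orbit G \<phi> w. card {l \<in> orbit G \<psi> W. I q l} = c" by blast
qed

text \<open>The points of L are the complement of an orbit, hence permuted by g. Two of them go to
  two points that are both on L and on its image.\<close>

lemma fixed_line:
  assumes "w \<in> P" "L \<in> Q" "orbit G \<phi> w = {q \<in> P. \<not> I q L}" "g \<in> carrier G"
  shows "\<psi> g L = L"
proof -
  obtain q r where qr: "q \<in> P" "r \<in> P" "q \<noteq> r" "I q L" "I r L"
    using two_points_on_line[OF assms(2)] .
  have "I (\<phi> g s) L" if "s \<in> P" "I s L" for s
    using pt.act_mem_orbit_iff[of w s g] that assms by auto
  moreover have "\<phi> g q \<noteq> \<phi> g r" using qr assms(4) pt.act_inj by blast
  ultimately show ?thesis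
    using incident_unique[of "\<phi> g q" "\<phi> g r" "\<psi> g L" L] qr assms by auto
qed

theorem cubic_flag_orbit:
  assumes w: "w \<in> P" "W \<in> Q" "I w W"
    and card: "card {(\<phi> g w, \<psi> g W) |g. g \<in> carrier G} = n ^ 3"
  obtains p L where "p \<in> P" "L \<in> Q" "I p L"
    "\<forall>g\<in>carrier G. \<phi> g p = p" "\<forall>g\<in>carrier G. \<psi> g L = L"
    "{(\<phi> g w, \<psi> g W) |g. g \<in> carrier G} =
      {(q, l). q \<in> P \<and> l \<in> Q \<and> I q l \<and> \<not> I q L \<and> \<not> I p l}"
proof -
  interpret dual: plane_action Q P "\<lambda>l p. I p l" n G \<psi> \<phi> by (rule dual_action)
  let ?Fl = "{(\<phi> g w, \<psi> g W) |g. g \<in> carrier G}"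
  let ?P = "orbit G \<phi> w" and ?Q = "orbit G \<psi> W"
  have sub: "?P \<subseteq> P" "?Q \<subseteq> Q" using w pt.orbit_subset ln.orbit_subset by auto
  have "{(\<psi> g W, \<phi> g w) |g. g \<in> carrier G} = prod.swap ` ?Fl" by auto
  then have card': "card {(\<psi> g W, \<phi> g w) |g. g \<in> carrier G} = n ^ 3"
    using card by (simp add: card_image)
  obtain c where c: "c \<in> {n, n + 1}" "\<And>q. q \<in> ?P \<Longrightarrow> card {l \<in> ?Q. I q l} = c"
    and card_orbit: "card ?P = n\<^sup>2"
    using cubic_flag_orbit_point_orbit[OF w card] by blast
  obtain d where d: "d \<in> {n, n + 1}" "\<And>l. l \<in> ?Q \<Longrightarrow> card {q \<in> ?P. I q l} = d"
    and card_orbit': "card ?Q = n\<^sup>2"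
    using dual.cubic_flag_orbit_point_orbit[OF w(2,1,3) card'] by blast
  have fin: "finite ?P" "finite ?Q" using sub finite_P finite_Q by (auto intro: finite_subset)
  \<comment> \<open>Count the incidences between the two orbits in both ways; as both orbits have
    n^2 elements, c = d.\<close>
  have "n\<^sup>2 * c = (\<Sum>q\<in>?P. card {l \<in> ?Q. I q l})" using c card_orbit by simp
  also have "\<dots> = (\<Sum>l\<in>?Q. d)"
    using sum_multicount_gen[of ?P ?Q I "\<lambda>_. d"] d fin by simp
  finally have "c = d" using card_orbit' n_gt_1 by simp
  have "c \<noteq> n + 1"
  proof
    assume "c = n + 1"
    \<comment> \<open>With full degrees the two orbits are closed under incidence. Joining w to any
      other point then puts that point in the orbit, although the orbit has only n^2 points.\<close>
    have Q_full: "l \<in> ?Q" if "q \<in> ?P" "l \<in> Q" "I q l" for q l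
    proof -
      have "{l \<in> ?Q. I q l} = {l \<in> Q. I q l}"
        using c(2)[OF that(1)] \<open>c = n + 1\<close> card_pencil[of q] sub that finite_Q
        by (intro card_subset_eq) auto
      then show ?thesis using that by blast
    qed
    have P_full: "q \<in> ?P" if "l \<in> ?Q" "q \<in> P" "I q l" for q l
    proof -
      have "{q \<in> ?P. I q l} = {q \<in> P. I q l}"
        using d(2)[OF that(1)] \<open>c = n + 1\<close> \<open>c = d\<close> card_line[of l] sub that finite_P
        by (intro card_subset_eq) auto
      then show ?thesis using that by blast
    qed
    have "w \<in> ?P" using w pt.orbit_refl by blast
    have "q \<in> ?P" if "q \<in> P" for q
      using join[of w q] Q_full[OF \<open>w \<in> ?P\<close>] P_full w that \<open>w \<in> ?P\<close> by metis
    then have "?P = P" using sub by blast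
    then show False using card_orbit card_P by simp
  qed
  then have c: "\<And>q. q \<in> ?P \<Longrightarrow> card {l \<in> ?Q. I q l} = n"
    and d: "\<And>l. l \<in> ?Q \<Longrightarrow> card {q \<in> ?P. I q l} = n"
    using c d \<open>c = d\<close> by auto
  obtain L where L: "L \<in> Q - ?Q" "?P = {q \<in> P. \<not> I q L}"
    using complement_eq_line[OF sub(1) card_orbit sub(2) d c] .
  obtain p where p: "p \<in> P - ?P" "?Q = {l \<in> Q. \<not> I p l}"
    using dual.complement_eq_line[OF sub(2) card_orbit' sub(1) c d] .
  \<comment> \<open>L is outside the line orbit, whose lines are exactly those that miss p.\<close>
  have "I p L" using p L by blast
  let ?Opp = "{(q, l). q \<in> P \<and> l \<in> Q \<and> I q l \<and> \<not> I q L \<and> \<not> I p l}"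
  \<comment> \<open>One inclusion is clear from the shape of the two orbits, and both sets have n^3
    elements.\<close>
  have "?Fl = ?Opp"
  proof (rule card_subset_eq)
    show "finite ?Opp"
      by (rule finite_subset[of _ "P \<times> Q"]) (use finite_P finite_Q in auto)
    have "?Fl \<subseteq> ?P \<times> ?Q" unfolding orbit_def by auto
    then show "?Fl \<subseteq> ?Opp" using w L(2) p(2) by auto
    show "card ?Fl = card ?Opp" using card card_opposite[of p L] p L \<open>I p L\<close> by auto
  qed
  then show thesis
    using that[of p L] p L \<open>I p L\<close> fixed_line[OF w(1) _ L(2)] dual.fixed_line[OF w(2) _ p(2)] by auto
qed

end

section \<open>Stabilizers and coset planes\<close>

lemma (in group) subset_set_mult:
  assumes H: "subgroup H G" and K: "subgroup K G"
  shows "H \<subseteq> H <#> K" and "K \<subseteq> H <#> K"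
proof -
  show "H \<subseteq> H <#> K"
  proof
    fix h assume h: "h \<in> H"
    then have "h \<otimes> \<one> \<in> H <#> K"
      unfolding set_mult_def using subgroup.one_closed[OF K] by blast
    then show "h \<in> H <#> K" using subgroup.mem_carrier[OF H h] by simp
  qed
  show "K \<subseteq> H <#> K"
  proof
    fix k assume k: "k \<in> K"
    then have "\<one> \<otimes> k \<in> H <#> K"
      unfolding set_mult_def using subgroup.one_closed[OF H] by blast
    then show "k \<in> H <#> K" using subgroup.mem_carrier[OF K k] by simp
  qed
qed

text \<open>The intersection x of W and L and the line X joining p and w are parameters pinned down
  by their incidences. Exchanging p, w, x with L, W, X therefore gives an instance of the same
  locale.\<close>

locale soft_action = plane_action P Q I n G \<phi> \<psi>
  for P :: "'p set" and Q :: "'l set" and I n and G (structure) and \<phi> \<psi> +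
  fixes p w x :: 'p and L W X :: 'l
  assumes p: "p \<in> P" and L: "L \<in> Q" and pL: "I p L"
    and p_fixed: "g \<in> carrier G \<Longrightarrow> \<phi> g p = p" and L_fixed: "g \<in> carrier G \<Longrightarrow> \<psi> g L = L"
    and w: "w \<in> P" and W: "W \<in> Q" and wW: "I w W" and wL: "\<not> I w L" and pW: "\<not> I p W"
    and x: "x \<in> P" and xL: "I x L" and xW: "I x W"
    and X: "X \<in> Q" and pX: "I p X" and wX: "I w X"
    and flag_transitive: "\<lbrakk>q \<in> P; l \<in> Q; I q l; \<not> I q L; \<not> I p l\<rbrakk> \<Longrightarrow>
      \<exists>g\<in>carrier G. \<phi> g w = q \<and> \<psi> g W = l"
begin

lemma dual_soft: "soft_action Q P (\<lambda>l p. I p l) n G \<psi> \<phi> L W X p w x"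
proof -
  interpret dual: plane_action Q P "\<lambda>l p. I p l" n G \<psi> \<phi> by (rule dual_action)
  show ?thesis
    by unfold_locales (use p L pL p_fixed L_fixed w W wW wL pW x xL xW X pX wX flag_transitive in blast)+
qed

section \<open>Orbits of the group that fixes the flag (p, L)\<close>

lemma x_ne_p: "x \<noteq> p" using xW pW by blast

lemma X_ne_L: "X \<noteq> L" using wX wL by blast

lemma act_on_L:
  assumes "g \<in> carrier G" "q \<in> P"
  shows "I (\<phi> g q) L \<longleftrightarrow> I q L"
  using incident_act[OF assms L] L_fixed[OF assms(1)] by simp

lemma act_on_p:
  assumes "g \<in> carrier G" "l \<in> Q"
  shows "I p (\<psi> g l) \<longleftrightarrow> I p l"
  using incident_act[OF assms(1) p assms(2)] p_fixed[OF assms(1)] by simp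

lemma act_eq_p_iff:
  assumes "g \<in> carrier G" "q \<in> P"
  shows "\<phi> g q = p \<longleftrightarrow> q = p"
proof
  assume "\<phi> g q = p"
  then have "\<phi> g q = \<phi> g p" using p_fixed[OF assms(1)] by simp
  then show "q = p" using pt.act_inj assms p by blast
qed (use assms p_fixed in simp)

text \<open>A point \<open>r\<close> off \<open>L\<close> and a point \<open>q \<noteq> p\<close> on \<open>L\<close> span a flag \<open>(r, rq)\<close> opposite to \<open>(p, L)\<close>.\<close>

lemma transitive_off_on:
  assumes "r \<in> P" "\<not> I r L" "q \<in> P" "I q L" "q \<noteq> p"
  obtains g where "g \<in> carrier G" "\<phi> g w = r" "\<phi> g x = q"
    "\<And>l. \<lbrakk>l \<in> Q; I p l; I r l\<rbrakk> \<Longrightarrow> \<psi> g X = l"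
proof -
  obtain m where m: "m \<in> Q" "I r m" "I q m" using join[of r q] assms by metis
  have pm: "\<not> I p m" using incident_unique[of p q m L] m assms p L pL by auto
  then obtain g where g: "g \<in> carrier G" "\<phi> g w = r" "\<psi> g W = m"
    using flag_transitive[OF assms(1) m(1,2) assms(2)] by blast
  \<comment> \<open>As x is the intersection of W and L, its image is the intersection of m and L,
    which is q. Likewise X, the join of p and w, goes to the join of p and r.\<close>
  have "I (\<phi> g x) m" "I (\<phi> g x) L"
    using incident_act[of g x W] g x W xW act_on_L xL by auto
  then have "\<phi> g x = q"
    using incident_unique[of "\<phi> g x" q m L] g x m assms pm pL L by auto
  moreover have "\<psi> g X = l" if "l \<in> Q" "I p l" "I r l" for l
  proof -
    have "I p (\<psi> g X)" "I r (\<psi> g X)"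
      using act_on_p g X pX incident_act[of g w X] w wX by auto
    then show ?thesis
      using incident_unique[of p r "\<psi> g X" l] that g X p assms pL by auto
  qed
  ultimately show thesis using that g by blast
qed

lemma orbit_w: "orbit G \<phi> w = {q \<in> P. \<not> I q L}"
proof
  show "orbit G \<phi> w \<subseteq> {q \<in> P. \<not> I q L}"
    using w wL act_on_L by (auto simp: orbit_def)
  show "{q \<in> P. \<not> I q L} \<subseteq> orbit G \<phi> w"
    using transitive_off_on[OF _ _ x xL x_ne_p] unfolding orbit_def by blast
qed

lemma orbit_x: "orbit G \<phi> x = {q \<in> P. I q L \<and> q \<noteq> p}"
proof
  show "orbit G \<phi> x \<subseteq> {q \<in> P. I q L \<and> q \<noteq> p}"
    using x xL act_on_L act_eq_p_iff x_ne_p by (auto simp: orbit_def)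
  show "{q \<in> P. I q L \<and> q \<noteq> p} \<subseteq> orbit G \<phi> x"
    using transitive_off_on[OF w wL] unfolding orbit_def by blast
qed

lemma card_orbit_x: "card (orbit G \<phi> x) = n"
proof -
  have "{q \<in> P. I q L \<and> q \<noteq> p} = {q \<in> P. I q L} - {p}" by blast
  then show ?thesis
    using orbit_x card_line[OF L] p pL finite_P by (simp add: card_Diff_singleton)
qed

text \<open>This is AM = G_X, and its dual is BM = G_x. An element fixing w fixes X, the join of p
  and w. Conversely A is transitive on the points of L other than p, so for g in G_X some a in A
  agrees with g at x, and \<open>inv a \<otimes> g\<close> lies in M.\<close>

lemma stabilizer_w_mult:
  "stabilizer G \<phi> w <#> (stabilizer G \<phi> x \<inter> stabilizer G \<psi> X) = stabilizer G \<psi> X"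
proof
  have A_sub: "stabilizer G \<phi> w \<subseteq> stabilizer G \<psi> X"
  proof
    fix g assume g: "g \<in> stabilizer G \<phi> w"
    then have "g \<in> carrier G" "I w (\<psi> g X)" "I p (\<psi> g X)"
      using incident_act[of g w X] w X wX act_on_p pX by (auto simp: stabilizer_def)
    then show "g \<in> stabilizer G \<psi> X"
      using incident_unique[of p w "\<psi> g X" X] p w X pX wX wL pL by (auto simp: stabilizer_def)
  qed
  then show "stabilizer G \<phi> w <#> (stabilizer G \<phi> x \<inter> stabilizer G \<psi> X) \<subseteq> stabilizer G \<psi> X"
    using ln.stabilizer_m_closed[OF X] unfolding set_mult_def by blast
  show "stabilizer G \<psi> X \<subseteq> stabilizer G \<phi> w <#> (stabilizer G \<phi> x \<inter> stabilizer G \<psi> X)"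
  proof
    fix g assume g: "g \<in> stabilizer G \<psi> X"
    then have [simp]: "g \<in> carrier G" by (simp add: stabilizer_def)
    obtain a where a: "a \<in> carrier G" "\<phi> a w = w" "\<phi> a x = \<phi> g x"
      using transitive_off_on[OF w wL, of "\<phi> g x"] x xL act_on_L act_eq_p_iff x_ne_p by force
    have A: "a \<in> stabilizer G \<phi> w" using a by (simp add: stabilizer_def)
    then have "a \<in> stabilizer G \<psi> X" using A_sub by blast
    then have "inv a \<otimes> g \<in> stabilizer G \<psi> X"
      using g ln.stabilizer_m_closed[OF X] ln.stabilizer_m_inv_closed[OF X] by blast
    moreover have "\<phi> (inv a \<otimes> g) x = x"
      using a x by (simp add: pt.composition_rule flip: a(3))
    then have "inv a \<otimes> g \<in> stabilizer G \<phi> x" using a by (simp add: stabilizer_def)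
    moreover have "g = a \<otimes> (inv a \<otimes> g)" using a by (simp flip: pt.m_assoc)
    ultimately show "g \<in> stabilizer G \<phi> w <#> (stabilizer G \<phi> x \<inter> stabilizer G \<psi> X)"
      using A unfolding set_mult_def by blast
  qed
qed

text \<open>Together with AM = G_X this yields G = AMB. The line gW meets X in a point r off L, and
  some c maps the flag (w, W) to (r, gW). Then c fixes X, the join of p and r, and
  \<open>inv c \<otimes> g\<close> fixes W.\<close>

lemma stabilizer_X_mult: "stabilizer G \<psi> X <#> stabilizer G \<psi> W = carrier G"
proof
  show "stabilizer G \<psi> X <#> stabilizer G \<psi> W \<subseteq> carrier G"
    by (auto simp: set_mult_def stabilizer_def)
  show "carrier G \<subseteq> stabilizer G \<psi> X <#> stabilizer G \<psi> W"
  proof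
    fix g assume g: "g \<in> carrier G"
    have "\<not> I p (\<psi> g W)" using g W pW act_on_p by simp
    then have "\<psi> g W \<noteq> X" using pX by blast
    then obtain r where r: "r \<in> P" "I r (\<psi> g W)" "I r X"
      using meet[of "\<psi> g W" X] g W X by auto
    have rp: "r \<noteq> p" using r \<open>\<not> I p (\<psi> g W)\<close> by blast
    then have "\<not> I r L"
      using incident_unique[of p r X L] p r X L pX pL X_ne_L by auto
    then obtain c where c: "c \<in> carrier G" "\<phi> c w = r" "\<psi> c W = \<psi> g W"
      using flag_transitive[of r "\<psi> g W"] r g W \<open>\<not> I p (\<psi> g W)\<close> by auto
    have "I r (\<psi> c X)" "I p (\<psi> c X)"
      using c incident_act[of c w X] w X wX pX act_on_p by auto
    then have "c \<in> stabilizer G \<psi> X"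
      using incident_unique[of p r "\<psi> c X" X] c p r X pX rp by (simp add: stabilizer_def)
    moreover have "inv c \<otimes> g \<in> stabilizer G \<psi> W"
      using c g W by (simp add: stabilizer_def ln.composition_rule flip: c(3))
    moreover have "g = c \<otimes> (inv c \<otimes> g)" using c g by (simp flip: pt.m_assoc)
    ultimately show "g \<in> stabilizer G \<psi> X <#> stabilizer G \<psi> W"
      unfolding set_mult_def by blast
  qed
qed

text \<open>If g is in AB then w is on gW, and if g is in BA then gw is on W. So w and gw are both
  on the lines W and gW, and two points or two lines must coincide.\<close>

lemma stabilizer_commuting_products:
  "(stabilizer G \<phi> w <#> stabilizer G \<psi> W) \<inter> (stabilizer G \<psi> W <#> stabilizer G \<phi> w) =
    stabilizer G \<phi> w \<union> stabilizer G \<psi> W"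
proof
  show "(stabilizer G \<phi> w <#> stabilizer G \<psi> W) \<inter> (stabilizer G \<psi> W <#> stabilizer G \<phi> w)
      \<subseteq> stabilizer G \<phi> w \<union> stabilizer G \<psi> W"
  proof
    fix g
    assume "g \<in> (stabilizer G \<phi> w <#> stabilizer G \<psi> W) \<inter> (stabilizer G \<psi> W <#> stabilizer G \<phi> w)"
    then obtain a b a' b' where ab: "g = a \<otimes> b" "g = b' \<otimes> a'"
      "a \<in> stabilizer G \<phi> w" "a' \<in> stabilizer G \<phi> w" "b \<in> stabilizer G \<psi> W" "b' \<in> stabilizer G \<psi> W"
      unfolding set_mult_def by blast
    then have carr: "a \<in> carrier G" "b \<in> carrier G" "a' \<in> carrier G" "b' \<in> carrier G"
      and fixed: "\<phi> a w = w" "\<phi> a' w = w" "\<psi> b W = W" "\<psi> b' W = W"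
      by (auto simp: stabilizer_def)
    have g: "g \<in> carrier G" using ab(1) carr by simp
    have "\<psi> g W = \<psi> a W" using ab(1) carr fixed W by (simp add: ln.composition_rule)
    then have "I w (\<psi> g W)" using incident_act[of a w W] carr fixed w W wW by simp
    moreover have "\<phi> g w = \<phi> b' w" using ab(2) carr fixed w by (simp add: pt.composition_rule)
    then have "I (\<phi> g w) W" using incident_act[of b' w W] carr fixed w W wW by simp
    moreover have "I (\<phi> g w) (\<psi> g W)" using g w W wW by simp
    ultimately have "\<phi> g w = w \<or> \<psi> g W = W"
      using incident_unique[of "\<phi> g w" w "\<psi> g W" W] g w W wW by auto
    then show "g \<in> stabilizer G \<phi> w \<union> stabilizer G \<psi> W" using g by (auto simp: stabilizer_def)
  qed
  show "stabilizer G \<phi> w \<union> stabilizer G \<psi> W \<subseteq>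
      (stabilizer G \<phi> w <#> stabilizer G \<psi> W) \<inter> (stabilizer G \<psi> W <#> stabilizer G \<phi> w)"
    using pt.subset_set_mult pt.stabilizer_subgroup[OF w] ln.stabilizer_subgroup[OF W] by simp
qed

text \<open>All orders come from the orbit-stabilizer theorem: the orbits of w and W have size n^2,
  those of x and X size n, that of the pair (x, X) size n^2, and that of the flag (w, W), with
  stabilizer \<open>?A \<inter> ?B\<close>, size n^3.\<close>

lemma coset_plane_data_stabilizers:
  "coset_plane_data G (stabilizer G \<phi> w) (stabilizer G \<psi> W)
     (stabilizer G \<phi> x \<inter> stabilizer G \<psi> X) n"
proof -
  interpret dual: soft_action Q P "\<lambda>l p. I p l" n G \<psi> \<phi> L W X p w x by (rule dual_soft)
  interpret flag: group_action G "P \<times> Q" "\<lambda>g. restrict (map_prod (\<phi> g) (\<psi> g)) (P \<times> Q)"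
    by (intro group_action_Times pt.group_action_axioms ln.group_action_axioms)
  let ?\<chi> = "\<lambda>g. restrict (map_prod (\<phi> g) (\<psi> g)) (P \<times> Q)"
  let ?A = "stabilizer G \<phi> w" and ?B = "stabilizer G \<psi> W"
    and ?M = "stabilizer G \<phi> x \<inter> stabilizer G \<psi> X"
  let ?k = "card (?A \<inter> ?B)"
  have stab: "stabilizer G ?\<chi> (q, l) = stabilizer G \<phi> q \<inter> stabilizer G \<psi> l"
    if "q \<in> P" "l \<in> Q" for q l using that by (auto simp: stabilizer_def)
  have "orbit G ?\<chi> (w, W) = {(q, l). q \<in> P \<and> l \<in> Q \<and> I q l \<and> \<not> I q L \<and> \<not> I p l}"
  proof
    show "orbit G ?\<chi> (w, W) \<subseteq> {(q, l). q \<in> P \<and> l \<in> Q \<and> I q l \<and> \<not> I q L \<and> \<not> I p l}"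
      using w W wW wL pW act_on_L act_on_p by (auto simp: orbit_def)
    show "{(q, l). q \<in> P \<and> l \<in> Q \<and> I q l \<and> \<not> I q L \<and> \<not> I p l} \<subseteq> orbit G ?\<chi> (w, W)"
      using flag_transitive w W by (fastforce simp: orbit_def)
  qed
  then have order: "n ^ 3 * ?k = order G"
    using flag.orbit_stabilizer_theorem[of "(w, W)"] w W stab[OF w W] card_opposite[OF p L pL] by simp
  have "orbit G ?\<chi> (x, X) = orbit G \<phi> x \<times> orbit G \<psi> X"
  proof
    show "orbit G ?\<chi> (x, X) \<subseteq> orbit G \<phi> x \<times> orbit G \<psi> X"
      using x X by (auto simp: orbit_def)
    show "orbit G \<phi> x \<times> orbit G \<psi> X \<subseteq> orbit G ?\<chi> (x, X)"
    proof clarify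
      fix q l assume "q \<in> orbit G \<phi> x" "l \<in> orbit G \<psi> X"
      then have q: "q \<in> P" "I q L" "q \<noteq> p" and l: "l \<in> Q" "I p l" "l \<noteq> L"
        unfolding orbit_x dual.orbit_x by auto
      \<comment> \<open>Any point r of l other than p will do: an element mapping w to r and x to q
        takes X to the join of p and r, which is l.\<close>
      obtain r where r: "r \<in> P" "I r l" "r \<noteq> p"
        using two_points_on_line[OF l(1)] by metis
      then have "\<not> I r L" using incident_unique[of p r l L] p L pL l by auto
      then obtain g where "g \<in> carrier G" "\<phi> g x = q" "\<psi> g X = l"
        using transitive_off_on[OF r(1) _ q] r l by metis
      then show "(q, l) \<in> orbit G ?\<chi> (x, X)" using x X by (force simp: orbit_def)
    qed
  qed
  then have M: "n\<^sup>2 * card ?M = order G"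
    using flag.orbit_stabilizer_theorem[of "(x, X)"] x X stab[OF x X]
    by (simp add: card_cartesian_product card_orbit_x dual.card_orbit_x power2_eq_square)
  have A: "n\<^sup>2 * card ?A = order G"
    using pt.orbit_stabilizer_theorem[OF w] card_off_line[OF L] by (simp add: orbit_w)
  have B: "n\<^sup>2 * card ?B = order G"
    using ln.orbit_stabilizer_theorem[OF W] dual.card_off_line[OF p] by (simp add: dual.orbit_w)
  have AM: "n * card (stabilizer G \<psi> X) = order G"
    using ln.orbit_stabilizer_theorem[OF X] by (simp add: dual.card_orbit_x)
  have BM: "n * card (stabilizer G \<phi> x) = order G"
    using pt.orbit_stabilizer_theorem[OF x] by (simp add: card_orbit_x)
  have n: "n > 0" using n_gt_1 by simp
  have eq1: "c = n * ?k" if "n\<^sup>2 * c = order G" for c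
    using that n unfolding order[symmetric] by (simp add: power2_eq_square power3_eq_cube)
  have eq2: "c = n\<^sup>2 * ?k" if "n * c = order G" for c
    using that n unfolding order[symmetric] by (simp add: power2_eq_square power3_eq_cube)
  have BM_eq: "?B <#> ?M = stabilizer G \<phi> x"
    using dual.stabilizer_w_mult by (simp add: Int_commute)
  show ?thesis
    unfolding coset_plane_data_def Let_def stabilizer_w_mult BM_eq
    using eq1[OF A] eq1[OF B] eq1[OF M] eq2[OF AM] eq2[OF BM] order finite_carrier
      stabilizer_X_mult stabilizer_commuting_products
      pt.is_group pt.stabilizer_subgroup[OF w] ln.stabilizer_subgroup[OF W]
      pt.stabilizer_subgroup[OF x] ln.stabilizer_subgroup[OF X]
      pt.subgroups_Inter_pair[OF pt.stabilizer_subgroup[OF x] ln.stabilizer_subgroup[OF X]]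
    by simp
qed

text \<open>Some g carries q to w, so the inclusion lets it carry l to X, and w is on X. Conversely,
  if q is on l, carrying q to w forces l onto the join of p and w.\<close>

lemma transporter_w_subset_iff:
  assumes "q \<in> P" "\<not> I q L" "l \<in> Q" "I p l"
  shows "{g \<in> carrier G. \<phi> g q = w} \<subseteq> {g \<in> carrier G. \<psi> g l = X} \<longleftrightarrow> I q l"
proof
  assume sub: "{g \<in> carrier G. \<phi> g q = w} \<subseteq> {g \<in> carrier G. \<psi> g l = X}"
  have "q \<in> orbit G \<phi> w" using assms by (simp add: orbit_w)
  then have "w \<in> orbit G \<phi> q" using pt.orbit_sym w assms by blast
  then obtain g where g: "g \<in> carrier G" "\<phi> g q = w" by (auto simp: orbit_def)
  then have "\<psi> g l = X" using sub by blast
  then show "I q l" using incident_act[of g q l] g assms wX by simp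
next
  assume "I q l"
  show "{g \<in> carrier G. \<phi> g q = w} \<subseteq> {g \<in> carrier G. \<psi> g l = X}"
  proof clarify
    fix g assume g: "g \<in> carrier G" "w = \<phi> g q"
    have "I w (\<psi> g l)" "I p (\<psi> g l)" using g assms \<open>I q l\<close> act_on_p by auto
    then show "\<psi> g l = X"
      using incident_unique[of p w "\<psi> g l" X] g(1) p w X pX wX wL pL assms by auto
  qed
qed

text \<open>A common element carries the pair (q, l) to the flag (w, W); when q is on l, the inverse
  of an element given by transitivity on opposite flags is one.\<close>

lemma transporters_meet_iff:
  assumes "q \<in> P" "\<not> I q L" "l \<in> Q" "\<not> I p l"
  shows "{g \<in> carrier G. \<phi> g q = w} \<inter> {g \<in> carrier G. \<psi> g l = W} \<noteq> {} \<longleftrightarrow> I q l"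
proof
  assume "{g \<in> carrier G. \<phi> g q = w} \<inter> {g \<in> carrier G. \<psi> g l = W} \<noteq> {}"
  then obtain g where "g \<in> carrier G" "\<phi> g q = w" "\<psi> g l = W" by blast
  then show "I q l" using incident_act[of g q l] assms wW by simp
next
  assume "I q l"
  then obtain g where g: "g \<in> carrier G" "\<phi> g w = q" "\<psi> g W = l"
    using flag_transitive assms by blast
  then have "inv g \<in> carrier G" "\<phi> (inv g) q = w" "\<psi> (inv g) l = W" using w W by auto
  then show "{g \<in> carrier G. \<phi> g q = w} \<inter> {g \<in> carrier G. \<psi> g l = W} \<noteq> {}" by blast
qed

end

text \<open>Serves points and lines alike: z is p and R means lying on L, or z is L and R means
  passing through p. The constructors c, d, e keep the three images apart.\<close>

lemma bij_betw_three_parts: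
  assumes "bij_betw f {q \<in> V. R q \<and> q \<noteq> z} D" "bij_betw g {q \<in> V. \<not> R q} E" "z \<in> V" "R z"
    "inj d" "inj e" "\<And>u. c \<noteq> d u" "\<And>u. c \<noteq> e u" "\<And>u v. d u \<noteq> e v"
  shows "bij_betw (\<lambda>q. if q = z then c else if R q then d (f q) else e (g q)) V
    ({c} \<union> e ` E \<union> d ` D)" (is "bij_betw ?h _ _")
proof (rule bij_betw_imageI)
  have f: "inj_on f {q \<in> V. R q \<and> q \<noteq> z}" "f ` {q \<in> V. R q \<and> q \<noteq> z} = D"
    and g: "inj_on g {q \<in> V. \<not> R q}" "g ` {q \<in> V. \<not> R q} = E"
    using assms(1,2) by (auto simp: bij_betw_def)
  show "inj_on ?h V"
    using f(1) g(1) assms(5,6) assms(7-9) assms(7-9)[symmetric]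
    by (auto simp: inj_on_def dest: injD)
  have "?h ` V = ?h ` ({z} \<union> {q \<in> V. \<not> R q} \<union> {q \<in> V. R q \<and> q \<noteq> z})"
    using assms(3) by (intro arg_cong[of _ _ "image ?h"]) auto
  also have "\<dots> = {c} \<union> e ` g ` {q \<in> V. \<not> R q} \<union> d ` f ` {q \<in> V. R q \<and> q \<noteq> z}"
    using assms(4) by (auto simp: image_iff)
  finally show "?h ` V = {c} \<union> e ` E \<union> d ` D" using f g by simp
qed

section \<open>The isomorphism with the coset plane\<close>

context soft_action
begin

lemma isomorphic_coset_plane:
  "isomorphic_structures \<lparr>points = P, lines = Q, incident = I\<rparr>
    (coset_plane G (stabilizer G \<phi> w) (stabilizer G \<psi> W) (stabilizer G \<phi> x \<inter> stabilizer G \<psi> X))"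
proof -
  interpret dual: soft_action Q P "\<lambda>l p. I p l" n G \<psi> \<phi> L W X p w x by (rule dual_soft)
  let ?fp = "\<lambda>q. if q = p then Point_inf else if I q L then Point_BM {g \<in> carrier G. \<phi> g q = x}
    else Point_A {g \<in> carrier G. \<phi> g q = w}"
  let ?fl = "\<lambda>l. if l = L then Line_inf else if I p l then Line_AM {g \<in> carrier G. \<psi> g l = X}
    else Line_B {g \<in> carrier G. \<psi> g l = W}"
  let ?\<sigma> = "coset_plane G (stabilizer G \<phi> w) (stabilizer G \<psi> W)
    (stabilizer G \<phi> x \<inter> stabilizer G \<psi> X)"
  have BM_eq: "stabilizer G \<psi> W <#> (stabilizer G \<phi> x \<inter> stabilizer G \<psi> X) = stabilizer G \<phi> x"
    using dual.stabilizer_w_mult by (simp add: Int_commute)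
  have "bij_betw ?fp P (points ?\<sigma>)"
    unfolding coset_plane_def BM_eq incidence_structure.select_convs
    using pt.bij_betw_orbit_rcosets[OF w] pt.bij_betw_orbit_rcosets[OF x] p pL
    unfolding orbit_w orbit_x by (intro bij_betw_three_parts) (auto intro: injI)
  moreover have "bij_betw ?fl Q (lines ?\<sigma>)"
    unfolding coset_plane_def stabilizer_w_mult incidence_structure.select_convs
    using ln.bij_betw_orbit_rcosets[OF W] ln.bij_betw_orbit_rcosets[OF X] L pL
    unfolding dual.orbit_w dual.orbit_x by (intro bij_betw_three_parts) (auto intro: injI)
  moreover have "I q l \<longleftrightarrow> incident ?\<sigma> (?fp q) (?fl l)" if q: "q \<in> P" and l: "l \<in> Q" for q l
  proof -
    \<comment> \<open>Otherwise l and L would share both p and q. This matches the coset plane,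
      where no BM-point is on an AM-line.\<close>
    have "\<not> I q l" if "q \<noteq> p" "I q L" "l \<noteq> L" "I p l"
      using incident_unique[of p q l L] p q l L pL that by auto
    \<comment> \<open>Inclusion of cosets settles q off L with l through p, and dually q on L with l
      not through p; intersection of cosets settles q off L with l not through p.\<close>
    then show ?thesis
      using q l p L pL transporter_w_subset_iff[of q l] dual.transporter_w_subset_iff[of l q]
        transporters_meet_iff[of q l]
      by (auto simp: coset_plane_def)
  qed
  ultimately show ?thesis
    unfolding isomorphic_structures_def incidence_isomorphism_def
    by (intro exI[of _ ?fp] exI[of _ ?fl]) simp
qed

end

section \<open>Groups of collineations\<close>

lemma isomorphic_structures_sym:
  assumes "isomorphic_structures \<pi> \<sigma>"
  shows "isomorphic_structures \<sigma> \<pi>"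
proof -
  obtain f g where fg: "bij_betw f (points \<pi>) (points \<sigma>)" "bij_betw g (lines \<pi>) (lines \<sigma>)"
    and inc: "\<forall>p\<in>points \<pi>. \<forall>l\<in>lines \<pi>. incident \<pi> p l \<longleftrightarrow> incident \<sigma> (f p) (g l)"
    using assms unfolding isomorphic_structures_def incidence_isomorphism_def by blast
  let ?f = "inv_into (points \<pi>) f" and ?g = "inv_into (lines \<pi>) g"
  have "bij_betw ?f (points \<sigma>) (points \<pi>)" "bij_betw ?g (lines \<sigma>) (lines \<pi>)"
    using fg by (simp_all add: bij_betw_inv_into)
  moreover have "incident \<sigma> q m \<longleftrightarrow> incident \<pi> (?f q) (?g m)"
    if "q \<in> points \<sigma>" "m \<in> lines \<sigma>" for q m
    using that inc fg calculation bij_betw_inv_into_right[OF fg(1), of q]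
      bij_betw_inv_into_right[OF fg(2), of m] bij_betwE by metis
  ultimately show ?thesis
    unfolding isomorphic_structures_def incidence_isomorphism_def by blast
qed

lemma finite_collineation_group:
  assumes "finite (points \<pi>)" "finite (lines \<pi>)"
  shows "finite (carrier (collineation_group \<pi>))"
proof (rule finite_subset)
  show "carrier (collineation_group \<pi>) \<subseteq>
      (points \<pi> \<rightarrow>\<^sub>E points \<pi>) \<times> (lines \<pi> \<rightarrow>\<^sub>E lines \<pi>)"
    by (auto simp: collineation_group_def PiE_def dest: Bij_imp_funcset Bij_imp_extensional
        elim: funcset_mem)
  show "finite ((points \<pi> \<rightarrow>\<^sub>E points \<pi>) \<times> (lines \<pi> \<rightarrow>\<^sub>E lines \<pi>))"
    using assms by (intro finite_cartesian_product finite_PiE) auto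
qed

text \<open>The product of collineations is componentwise, so the two projections are homomorphisms
  and serve as the actions on points and on lines.\<close>

lemma plane_action_collineations:
  assumes "finite_projective_plane \<pi>" "has_plane_order \<pi> n" "n > 1"
    and H: "subgroup H (collineation_group \<pi>)"
  shows "plane_action (points \<pi>) (lines \<pi>) (incident \<pi>) n
    (collineation_group \<pi>\<lparr>carrier := H\<rparr>) fst snd"
proof -
  let ?K = "collineation_group \<pi>\<lparr>carrier := H\<rparr>"
  have sub: "H \<subseteq> carrier (collineation_group \<pi>)" using H by (rule subgroup.subset)
  then have H_memD: "fst h \<in> Bij (points \<pi>)" "snd h \<in> Bij (lines \<pi>)"
    "incidence_isomorphism \<pi> \<pi> (fst h) (snd h)" if "h \<in> H" for h
    using that by (auto simp: collineation_group_def)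
  have K: "group ?K"
    using group.subgroup_imp_group[OF group_collineation_group H] .
  have mult: "g \<otimes>\<^bsub>collineation_group \<pi>\<^esub> h =
      (fst g \<otimes>\<^bsub>BijGroup (points \<pi>)\<^esub> fst h, snd g \<otimes>\<^bsub>BijGroup (lines \<pi>)\<^esub> snd h)" for g h
    by (simp add: collineation_group_def DirProd_def case_prod_unfold)
  have "fst \<in> hom ?K (BijGroup (points \<pi>))" "snd \<in> hom ?K (BijGroup (lines \<pi>))"
    using H_memD by (auto simp: hom_def mult) (auto simp: BijGroup_def)
  then have "group_action ?K (points \<pi>) fst" "group_action ?K (lines \<pi>) snd"
    using K group_BijGroup by (simp_all add: group_action_def group_hom_def group_hom_axioms_def)
  moreover have "finite H"
    using assms(1) finite_collineation_group[of \<pi>] finite_subset[OF sub]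
    by (simp add: finite_projective_plane_def)
  moreover have "incident \<pi> (fst g q) (snd g l) \<longleftrightarrow> incident \<pi> q l"
    if "g \<in> H" "q \<in> points \<pi>" "l \<in> lines \<pi>" for g q l
    using H_memD(3)[OF that(1)] that unfolding incidence_isomorphism_def by blast
  ultimately show ?thesis
    using finite_plane_of_projective_plane[OF assms(1-3)]
    by (simp add: plane_action_def plane_action_axioms_def)
qed

text \<open>There are n^2 points off L, and n lines through each of them avoid p. Hence an opposite
  flag (w, W) exists, and with it x and X, so the stabilizers above are available.\<close>

lemma coset_plane_of_soft_at:
  assumes "finite_projective_plane \<pi>" "has_plane_order \<pi> n" "n > 1"
    and H: "subgroup H (collineation_group \<pi>)" and soft: "soft_at \<pi> H p L"
  obtains A B M where "coset_plane_data (collineation_group \<pi>\<lparr>carrier := H\<rparr>) A B M n"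
    "isomorphic_structures \<pi> (coset_plane (collineation_group \<pi>\<lparr>carrier := H\<rparr>) A B M)"
proof -
  let ?K = "collineation_group \<pi>\<lparr>carrier := H\<rparr>"
  interpret plane_action "points \<pi>" "lines \<pi>" "incident \<pi>" n ?K fst snd
    using assms by (intro plane_action_collineations)
  have p: "p \<in> points \<pi>" and L: "L \<in> lines \<pi>" and pL: "incident \<pi> p L"
    using soft by (auto simp: soft_at_def flags_def)
  have "card {q \<in> points \<pi>. \<not> incident \<pi> q L} \<noteq> 0" using card_off_line[OF L] n_gt_1 by simp
  then have "{q \<in> points \<pi>. \<not> incident \<pi> q L} \<noteq> {}" by (metis card.empty)
  then obtain w where w: "w \<in> points \<pi>" "\<not> incident \<pi> w L" by blast
  then have pw: "p \<noteq> w" using pL by blast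
  have "card {l \<in> lines \<pi>. incident \<pi> w l \<and> \<not> incident \<pi> p l} \<noteq> 0"
    using card_pencil_avoiding[OF p w(1) pw] n_gt_1 by simp
  then have "{l \<in> lines \<pi>. incident \<pi> w l \<and> \<not> incident \<pi> p l} \<noteq> {}" by (metis card.empty)
  then obtain W where W: "W \<in> lines \<pi>" "incident \<pi> w W" "\<not> incident \<pi> p W" by blast
  obtain x where x: "x \<in> points \<pi>" "incident \<pi> x L" "incident \<pi> x W"
    using meet[OF L W(1)] W pL by blast
  obtain X where X: "X \<in> lines \<pi>" "incident \<pi> p X" "incident \<pi> w X"
    using join[OF p w(1) pw] by blast
  have fixed: "fst h p = p" "snd h L = L" if "h \<in> H" for h
    using soft that by (auto simp: soft_at_def flag_action_def)
  have "\<exists>h\<in>H. fst h w = q \<and> snd h W = l"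
    if "q \<in> points \<pi>" "l \<in> lines \<pi>" "incident \<pi> q l" "\<not> incident \<pi> q L" "\<not> incident \<pi> p l" for q l
  proof -
    have "(w, W) \<in> opposite_flags \<pi> p L" "(q, l) \<in> opposite_flags \<pi> p L"
      using that w W by (auto simp: opposite_flags_def flags_def)
    then obtain h where "h \<in> H" "flag_action h (w, W) = (q, l)"
      using soft unfolding soft_at_def by blast
    then show ?thesis by (auto simp: flag_action_def)
  qed
  then interpret soft_action "points \<pi>" "lines \<pi>" "incident \<pi>" n ?K fst snd p w x L W X
    by unfold_locales (use p L pL w W x X fixed in auto)
  show thesis
  proof (rule that[OF coset_plane_data_stabilizers])
    have eq: "\<lparr>points = points \<pi>, lines = lines \<pi>, incident = incident \<pi>\<rparr> = \<pi>" by (cases \<pi>) simp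
    then show "isomorphic_structures \<pi> (coset_plane ?K (stabilizer ?K fst w) (stabilizer ?K snd W)
        (stabilizer ?K fst x \<inter> stabilizer ?K snd X))"
      using isomorphic_coset_plane unfolding eq by simp
  qed
qed

lemma soft_at_of_cubic_flag_orbit:
  assumes "finite_projective_plane \<pi>" "has_plane_order \<pi> n" "n > 1"
    and H: "subgroup H (collineation_group \<pi>)" and f: "f \<in> flags \<pi>"
    and card: "card (orbit (collineation_group \<pi>\<lparr>carrier := H\<rparr>) flag_action f) = n ^ 3"
  obtains p L where "soft_at \<pi> H p L"
proof -
  let ?K = "collineation_group \<pi>\<lparr>carrier := H\<rparr>"
  interpret plane_action "points \<pi>" "lines \<pi>" "incident \<pi>" n ?K fst snd
    using assms by (intro plane_action_collineations)
  obtain w W where wW: "f = (w, W)" "w \<in> points \<pi>" "W \<in> lines \<pi>" "incident \<pi> w W"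
    using f by (auto simp: flags_def)
  have orbit: "orbit ?K flag_action f = {(fst g w, snd g W) |g. g \<in> carrier ?K}"
    by (simp add: orbit_def flag_action_def wW(1))
  obtain p L where p: "p \<in> points \<pi>" "L \<in> lines \<pi>" "incident \<pi> p L"
    and fixed: "\<forall>g\<in>carrier ?K. fst g p = p" "\<forall>g\<in>carrier ?K. snd g L = L"
    and opp: "{(fst g w, snd g W) |g. g \<in> carrier ?K} =
      {(q, l). q \<in> points \<pi> \<and> l \<in> lines \<pi> \<and> incident \<pi> q l \<and> \<not> incident \<pi> q L \<and> \<not> incident \<pi> p l}"
    using cubic_flag_orbit[OF wW(2-4) card[unfolded orbit]] .
  have "\<exists>h\<in>H. flag_action h y = z"
    if y: "y \<in> opposite_flags \<pi> p L" and z: "z \<in> opposite_flags \<pi> p L" for y z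
  proof -
    have *: "\<exists>g\<in>H. (fst g w, snd g W) = u" if "u \<in> opposite_flags \<pi> p L" for u
    proof -
      have "u \<in> {(fst g w, snd g W) |g. g \<in> carrier ?K}"
        using that unfolding opp opposite_flags_def flags_def by auto
      then obtain g where "g \<in> H" "u = (fst g w, snd g W)" by auto
      then show ?thesis by blast
    qed
    obtain g where g: "g \<in> H" "y = (fst g w, snd g W)" using *[OF y] by blast
    obtain h where h: "h \<in> H" "z = (fst h w, snd h W)" using *[OF z] by blast
    \<comment> \<open>The opposite flags form one orbit, so y and z are reached from (w, W) by g and
      h, and the passage from y to z goes back through (w, W).\<close>
    let ?k = "h \<otimes>\<^bsub>?K\<^esub> inv\<^bsub>?K\<^esub> g"
    have gh: "g \<in> carrier ?K" "h \<in> carrier ?K" using g h by simp_all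
    then have "?k \<in> carrier ?K" by (intro pt.m_closed pt.inv_closed)
    moreover have "fst ?k (fst g w) = fst h w"
      using gh wW pt.composition_rule[of "fst g w" h "inv\<^bsub>?K\<^esub> g"] pt.inv_act[of g w]
        pt.act_closed[of g w] pt.inv_closed[of g] by metis
    moreover have "snd ?k (snd g W) = snd h W"
      using gh wW ln.composition_rule[of "snd g W" h "inv\<^bsub>?K\<^esub> g"] ln.inv_act[of g W]
        ln.act_closed[of g W] pt.inv_closed[of g] by metis
    ultimately show ?thesis
      using g h by (intro bexI[of _ ?k]) (simp_all add: flag_action_def)
  qed
  then have "soft_at \<pi> H p L"
    using p fixed by (auto simp: soft_at_def flags_def flag_action_def)
  then show thesis by (rule that)
qed

theorem theorem2p9:
  shows "(\<forall>(\<pi> :: ('p, 'l) incidence_structure) (n :: nat) (G :: (('p \<Rightarrow> 'p) \<times> ('l \<Rightarrow> 'l)) set).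
            n > 1 \<and> finite_projective_plane \<pi> \<and> has_plane_order \<pi> n \<and>
            subgroup G (collineation_group \<pi>) \<and>
            (\<exists>x\<in>flags \<pi>. card (orbit (collineation_group \<pi>\<lparr>carrier := G\<rparr>) flag_action x) = n ^ 3)
          \<longrightarrow>
            (\<exists>p L. soft_at \<pi> G p L) \<and> soft_group \<pi> G \<and> soft_plane \<pi> \<and>
            (\<exists>A B M. coset_plane_data (collineation_group \<pi>\<lparr>carrier := G\<rparr>) A B M n \<and>
               isomorphic_structures
                 (coset_plane (collineation_group \<pi>\<lparr>carrier := G\<rparr>) A B M) \<pi>))
       \<and> (\<forall>\<sigma> :: ('q, 'm) incidence_structure. soft_plane \<sigma> \<longrightarrow>
            (\<exists>n > 1. has_plane_order \<sigma> n \<and>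
               (\<exists>(K :: (('q \<Rightarrow> 'q) \<times> ('m \<Rightarrow> 'm)) monoid) A B M.
                  coset_plane_data K A B M n \<and>
                  isomorphic_structures \<sigma> (coset_plane K A B M))))"
proof (intro conjI allI impI)
  fix \<pi> :: "('p, 'l) incidence_structure" and n :: nat and G :: "(('p \<Rightarrow> 'p) \<times> ('l \<Rightarrow> 'l)) set"
  assume "n > 1 \<and> finite_projective_plane \<pi> \<and> has_plane_order \<pi> n \<and>
    subgroup G (collineation_group \<pi>) \<and>
    (\<exists>x\<in>flags \<pi>. card (orbit (collineation_group \<pi>\<lparr>carrier := G\<rparr>) flag_action x) = n ^ 3)"
  then have \<pi>: "finite_projective_plane \<pi>" "has_plane_order \<pi> n" "n > 1"
    "subgroup G (collineation_group \<pi>)"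
    and orbit: "\<exists>x\<in>flags \<pi>. card (orbit (collineation_group \<pi>\<lparr>carrier := G\<rparr>) flag_action x) = n ^ 3"
    by auto
  obtain p L where soft: "soft_at \<pi> G p L"
    using orbit soft_at_of_cubic_flag_orbit[OF \<pi>] by blast
  then show "\<exists>p L. soft_at \<pi> G p L" by blast
  then show "soft_group \<pi> G" using \<pi> by (simp add: soft_group_def)
  then show "soft_plane \<pi>" by (auto simp: soft_plane_def)
  show "\<exists>A B M. coset_plane_data (collineation_group \<pi>\<lparr>carrier := G\<rparr>) A B M n \<and>
      isomorphic_structures (coset_plane (collineation_group \<pi>\<lparr>carrier := G\<rparr>) A B M) \<pi>"
    using coset_plane_of_soft_at[OF \<pi> soft] isomorphic_structures_sym by metis
next
  fix \<sigma> :: "('q, 'm) incidence_structure"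
  assume "soft_plane \<sigma>"
  then obtain H p L where \<sigma>: "finite_projective_plane \<sigma>"
    and H: "subgroup H (collineation_group \<sigma>)" "soft_at \<sigma> H p L"
    unfolding soft_plane_def soft_group_def by blast
  \<comment> \<open>Softness mentions no order, so n is read off the plane; the group K will be the
    soft group \<open>H\<close> itself.\<close>
  obtain n where n: "n > 1" "has_plane_order \<sigma> n"
    using finite_projective_plane_order[OF \<sigma>] .
  show "\<exists>n > 1. has_plane_order \<sigma> n \<and>
      (\<exists>(K :: (('q \<Rightarrow> 'q) \<times> ('m \<Rightarrow> 'm)) monoid) A B M.
        coset_plane_data K A B M n \<and> isomorphic_structures \<sigma> (coset_plane K A B M))"
    using coset_plane_of_soft_at[OF \<sigma> n(2,1) H] n by metis
qed

end
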